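(* Let $(q_n),(r_n)$ be complex sequences vanishing faster than any negative power of $|n|$ as $n\to\pm\infty$ with $1-q_nr_n\neq0$ and $1+q_nr_{n+1}\ne0$ for all $n$, and let $u_n,v_n,p_n,s_n,D_\infty,E_\infty$ be as in the context. With the notation of the context, for $1\le j\le N$ and $1\le j'\le\bar N$, $$C_j^{(u,v)}=C_j^{(p,s)}(I-A_j^{-2}),\qquad \bar C_{j'}^{(p,s)}=\bar C_{j'}^{(u,v)}\big[I-(\bar A_{j'})^{-2}\big],$$ hence $C^{(u,v)}=C^{(p,s)}(I-A^{-2})$ and $\bar C^{(p,s)}=\bar C^{(u,v)}[I-(\bar A)^{-2}]$; moreover $$C_j^{(q,r)}=\frac{E_\infty}{D_\infty}C_j^{(p,s)},\qquad \bar C_{j'}^{(q,r)}=\frac{D_\infty}{E_\infty}\bar C_{j'}^{(p,s)},$$ hence $C^{(p,s)}=\frac{D_\infty}{E_\infty}C^{(q,r)}$, $\bar C^{(p,s)}=\frac{E_\infty}{D_\infty}\bar C^{(q,r)}$, and consequently $$C^{(u,v)}=\frac{D_\infty}{E_\infty}C^{(q,r)}(I-A^{-2}),\qquad \bar C^{(u,v)}=\frac{E_\infty}{D_\infty}\bar C^{(q,r)}\big[I-(\bar A)^{-2}\big]^{-1}.$$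
   Context: System (Q): $\begin{bmatrix}\alpha_n\\ \beta_n\end{bmatrix}=\begin{bmatrix} z & (z-z^{-1})q_n\\ z r_n & z^{-1}+(z-z^{-1})q_nr_n\end{bmatrix}\begin{bmatrix}\alpha_{n+1}\\ \beta_{n+1}\end{bmatrix}$; system (U) with potentials $(a,b)$: $\begin{bmatrix}\xi_n\\ \eta_n\end{bmatrix}=\begin{bmatrix} z & z a_n\\ z^{-1}b_n & z^{-1}\end{bmatrix}\begin{bmatrix}\xi_{n+1}\\ \eta_{n+1}\end{bmatrix}$. $D_n=\prod_{j\le n}(1-q_jr_j)$, $E_n=\prod_{j\le n}(1+q_jr_{j+1})$, $D_\infty,E_\infty$ the full products; $u_n=q_nE_{n-1}/D_n$, $v_n=(-r_n+r_{n+1}-q_nr_nr_{n+1})D_{n-1}/E_n$, $p_n=(q_n-q_{n+1}-q_nq_{n+1}r_{n+1})E_{n-1}/D_{n+1}$, $s_n=r_{n+1}D_n/E_n$. Superscripts $(q,r),(u,v),(p,s)$ refer to (Q) and to (U) with potentials $(u,v)$, $(p,s)$. For $|z|=1$ the Jost solutions (overbars not complex conjugation) are $\psi_n=\begin{bmatrix}o(1)\\ z^n[1+o(1)]\end{bmatrix}$, $\bar\psi_n=\begin{bmatrix}z^{-n}[1+o(1)]\\ o(1)\end{bmatrix}$ ($n\to+\infty$), $\phi_n=\begin{bmatrix}z^{-n}[1+o(1)]\\ o(1)\end{bmatrix}$, $\bar\phi_n=\begin{bmatrix}o(1)\\ z^{n}[1+o(1)]\end{bmatrix}$ ($n\to-\infty$),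 extended analytically in $z$ ($\psi_n,\phi_n$ to $0<|z|<1$; $\bar\psi_n,\bar\phi_n$ to $|z|>1$). Right transmission coefficients: first component of $\phi_n$ $=(1/T_{\rm r})z^{-n}[1+o(1)]$, second component of $\bar\phi_n$ $=(1/\bar T_{\rm r})z^n[1+o(1)]$ as $n\to+\infty$ (for (Q) these are $T^{(q,r)},\bar T^{(q,r)}$), meromorphic in $|z|<1$, resp. $|z|>1$. The three systems have common poles: the poles in $0<|z|<1$ are $\pm z_j$, $1\le j\le N$, with multiplicity $m_j$, and the poles in $|z|>1$ are $\pm\bar z_j$, $1\le j\le\bar N$, with multiplicity $\bar m_j$. Residues: $T_{\rm r}=\sum_{k=1}^{m_j}t_{jk}(z-z_j)^{-k}+O(1)$ as $z\to z_j$, and $\bar T_{\rm r}=\sum_{k=1}^{\bar m_j}\bar t_{jk}(z-\bar z_j)^{-k}+O(1)$ as $z\to\bar z_j$. Dependency constants $\gamma_{jk}$ ($0\le k\le m_j-1$): $\frac{d^k\phi_n(z_j)}{dz^k}=\sum_{l=0}^k\binom kl\gamma_{j(k-l)}\frac{d^l\psi_n(z_j)}{dz^l}$ for all $n$; $\bar\gamma_{jk}$ analogously with $\bar\phi_n,\bar\psi_n,\bar z_j,\bar m_j$. Norming constants (for each system): $c_{jk}=-2\sum_{l=0}^{m_j-1-k}t_{j(k+1+l)}\gamma_{jl}/l!$ ($0\le k\le m_j-1$), $\bar c_{jk}=2\sum_{l=0}^{\bar m_j-1-k}\bar t_{j(k+1+l)}\bar\gamma_{jl}/l!$ ($0\le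 k\le\bar m_j-1$). Matrices: $A_j$ is the $m_j\times m_j$ Jordan block with $z_j$ on the diagonal and $1$ on the superdiagonal; $C_j=\begin{bmatrix}c_{j(m_j-1)}&c_{j(m_j-2)}&\cdots&c_{j0}\end{bmatrix}$; $\bar A_j$, $\bar C_j=\begin{bmatrix}\bar c_{j(\bar m_j-1)}&\cdots&\bar c_{j0}\end{bmatrix}$ analogously with $\bar z_j,\bar m_j$; $A=\mathrm{diag}(A_1,\dots,A_N)$, $C=\begin{bmatrix}C_1&\cdots&C_N\end{bmatrix}$, $\bar A=\mathrm{diag}(\bar A_1,\dots,\bar A_{\bar N})$, $\bar C=\begin{bmatrix}\bar C_1&\cdots&\bar C_{\bar N}\end{bmatrix}$; superscripts on $C,C_j,\bar C,\bar C_j$ indicate the system. *)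

theory Defs
  imports "HOL-Complex_Analysis.Complex_Analysis"
    "Jordan_Normal_Form.Jordan_Normal_Form" "Jordan_Normal_Form.Determinant"
begin

definition rapid_decay :: "(int \<Rightarrow> complex) \<Rightarrow> bool" where
  "rapid_decay f \<longleftrightarrow> (\<forall>k::nat.
     ((\<lambda>n. (real_of_int \<bar>n\<bar>) ^ k * cmod (f n)) \<longlongrightarrow> 0) at_top \<and>
     ((\<lambda>n. (real_of_int \<bar>n\<bar>) ^ k * cmod (f n)) \<longlongrightarrow> 0) at_bot)"

definition prod_upto :: "(int \<Rightarrow> complex) \<Rightarrow> int \<Rightarrow> complex" where
  "prod_upto f n = lim (\<lambda>m::nat. \<Prod>j\<in>{n - int m..n}. f j)"

definition prod_all :: "(int \<Rightarrow> complex) \<Rightarrow> complex" where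
  "prod_all f = lim (\<lambda>m::nat. \<Prod>j\<in>{- int m..int m}. f j)"

definition Dn :: "(int \<Rightarrow> complex) \<Rightarrow> (int \<Rightarrow> complex) \<Rightarrow> int \<Rightarrow> complex" where
  "Dn q r = prod_upto (\<lambda>j. 1 - q j * r j)"
definition En :: "(int \<Rightarrow> complex) \<Rightarrow> (int \<Rightarrow> complex) \<Rightarrow> int \<Rightarrow> complex" where
  "En q r = prod_upto (\<lambda>j. 1 + q j * r (j + 1))"
definition Dinf :: "(int \<Rightarrow> complex) \<Rightarrow> (int \<Rightarrow> complex) \<Rightarrow> complex" where
  "Dinf q r = prod_all (\<lambda>j. 1 - q j * r j)"
definition Einf :: "(int \<Rightarrow> complex) \<Rightarrow> (int \<Rightarrow> complex) \<Rightarrow> complex" where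
  "Einf q r = prod_all (\<lambda>j. 1 + q j * r (j + 1))"

definition pot_u :: "(int \<Rightarrow> complex) \<Rightarrow> (int \<Rightarrow> complex) \<Rightarrow> int \<Rightarrow> complex" where
  "pot_u q r n = q n * En q r (n - 1) / Dn q r n"
definition pot_v :: "(int \<Rightarrow> complex) \<Rightarrow> (int \<Rightarrow> complex) \<Rightarrow> int \<Rightarrow> complex" where
  "pot_v q r n = (- r n + r (n + 1) - q n * r n * r (n + 1)) * Dn q r (n - 1) / En q r n"
definition pot_p :: "(int \<Rightarrow> complex) \<Rightarrow> (int \<Rightarrow> complex) \<Rightarrow> int \<Rightarrow> complex" where
  "pot_p q r n = (q n - q (n + 1) - q n * q (n + 1) * r (n + 1)) * En q r (n - 1) / Dn q r (n + 1)"
definition pot_s :: "(int \<Rightarrow> complex) \<Rightarrow> (int \<Rightarrow> complex) \<Rightarrow> int \<Rightarrow> complex" where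
  "pot_s q r n = r (n + 1) * Dn q r n / En q r n"

text \<open>A system is given by its transfer map: a solution w satisfies w n = S z n (w (n+1)).\<close>
type_synonym system = "complex \<Rightarrow> int \<Rightarrow> complex \<times> complex \<Rightarrow> complex \<times> complex"

definition sysQ :: "(int \<Rightarrow> complex) \<Rightarrow> (int \<Rightarrow> complex) \<Rightarrow> system" where
  "sysQ q r z n w = (z * fst w + (z - inverse z) * q n * snd w,
                     z * r n * fst w + (inverse z + (z - inverse z) * q n * r n) * snd w)"

definition sysU :: "(int \<Rightarrow> complex) \<Rightarrow> (int \<Rightarrow> complex) \<Rightarrow> system" where
  "sysU a b z n w = (z * fst w + z * a n * snd w,
                     inverse z * b n * fst w + inverse z * snd w)"

definition is_sol :: "system \<Rightarrow> complex \<Rightarrow> (int \<Rightarrow> complex \<times> complex) \<Rightarrow> bool" where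
  "is_sol S z w \<longleftrightarrow> (\<forall>n. w n = S z n (w (n + 1)))"

definition inner_ext :: "(complex \<Rightarrow> complex) \<Rightarrow> bool" where
  "inner_ext f \<longleftrightarrow> f holomorphic_on {z. 0 < cmod z \<and> cmod z < 1}
                    \<and> continuous_on {z. 0 < cmod z \<and> cmod z \<le> 1} f"

definition outer_ext :: "(complex \<Rightarrow> complex) \<Rightarrow> bool" where
  "outer_ext f \<longleftrightarrow> f holomorphic_on {z. 1 < cmod z} \<and> continuous_on {z. 1 \<le> cmod z} f"

text \<open>Scattering data of a system: Jost solutions psi, psib (psi-bar), phi, phib (phi-bar),
  the reciprocals tinv = 1/T_r and tinvb = 1/Tbar_r of the right transmission coefficients,
  and dependency constants gam j k, gamb j k.\<close>
record sdata =
  jpsi  :: "complex \<Rightarrow> int \<Rightarrow> complex \<times> complex"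
  jpsib :: "complex \<Rightarrow> int \<Rightarrow> complex \<times> complex"
  jphi  :: "complex \<Rightarrow> int \<Rightarrow> complex \<times> complex"
  jphib :: "complex \<Rightarrow> int \<Rightarrow> complex \<times> complex"
  tinv  :: "complex \<Rightarrow> complex"
  tinvb :: "complex \<Rightarrow> complex"
  gam   :: "nat \<Rightarrow> nat \<Rightarrow> complex"
  gamb  :: "nat \<Rightarrow> nat \<Rightarrow> complex"

definition jost_solutions :: "system \<Rightarrow> sdata \<Rightarrow> bool" where
  "jost_solutions S d \<longleftrightarrow>
     (\<forall>z. 0 < cmod z \<and> cmod z \<le> 1 \<longrightarrow> is_sol S z (jpsi d z) \<and> is_sol S z (jphi d z)) \<and>
     (\<forall>z. 1 \<le> cmod z \<longrightarrow> is_sol S z (jpsib d z) \<and> is_sol S z (jphib d z)) \<and>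
     (\<forall>n. inner_ext (\<lambda>z. fst (jpsi d z n)) \<and> inner_ext (\<lambda>z. snd (jpsi d z n)) \<and>
          inner_ext (\<lambda>z. fst (jphi d z n)) \<and> inner_ext (\<lambda>z. snd (jphi d z n)) \<and>
          outer_ext (\<lambda>z. fst (jpsib d z n)) \<and> outer_ext (\<lambda>z. snd (jpsib d z n)) \<and>
          outer_ext (\<lambda>z. fst (jphib d z n)) \<and> outer_ext (\<lambda>z. snd (jphib d z n))) \<and>
     (\<forall>z. cmod z = 1 \<longrightarrow>
        ((\<lambda>n. fst (jpsi d z n)) \<longlongrightarrow> 0) at_top \<and>
        ((\<lambda>n. snd (jpsi d z n) * z powi (- n)) \<longlongrightarrow> 1) at_top \<and>
        ((\<lambda>n. fst (jpsib d z n) * z powi n) \<longlongrightarrow> 1) at_top \<and>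
        ((\<lambda>n. snd (jpsib d z n)) \<longlongrightarrow> 0) at_top \<and>
        ((\<lambda>n. fst (jphi d z n) * z powi n) \<longlongrightarrow> 1) at_bot \<and>
        ((\<lambda>n. snd (jphi d z n)) \<longlongrightarrow> 0) at_bot \<and>
        ((\<lambda>n. fst (jphib d z n)) \<longlongrightarrow> 0) at_bot \<and>
        ((\<lambda>n. snd (jphib d z n) * z powi (- n)) \<longlongrightarrow> 1) at_bot)"

definition transmission :: "sdata \<Rightarrow> bool" where
  "transmission d \<longleftrightarrow> inner_ext (tinv d) \<and> outer_ext (tinvb d) \<and>
     (\<forall>z. cmod z = 1 \<longrightarrow>
        ((\<lambda>n. fst (jphi d z n) * z powi n) \<longlongrightarrow> tinv d z) at_top \<and>
        ((\<lambda>n. snd (jphib d z n) * z powi (- n)) \<longlongrightarrow> tinvb d z) at_top)"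

text \<open>Pole configuration: poles +-z_j (1 \<le> j \<le> N) in 0<|z|<1 of multiplicity m_j,
  poles +-zb_j (1 \<le> j \<le> Nb) in |z|>1 of multiplicity mb_j.\<close>
definition pole_config :: "nat \<Rightarrow> (nat \<Rightarrow> complex) \<Rightarrow> (nat \<Rightarrow> nat) \<Rightarrow>
    nat \<Rightarrow> (nat \<Rightarrow> complex) \<Rightarrow> (nat \<Rightarrow> nat) \<Rightarrow> bool" where
  "pole_config N zs ms Nb zbs mbs \<longleftrightarrow>
     (\<forall>j\<in>{1..N}. 0 < cmod (zs j) \<and> cmod (zs j) < 1 \<and> 1 \<le> ms j) \<and>
     (\<forall>j\<in>{1..N}. \<forall>j'\<in>{1..N}. j \<noteq> j' \<longrightarrow> zs j \<noteq> zs j' \<and> zs j \<noteq> - zs j') \<and>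
     (\<forall>j\<in>{1..Nb}. 1 < cmod (zbs j) \<and> 1 \<le> mbs j) \<and>
     (\<forall>j\<in>{1..Nb}. \<forall>j'\<in>{1..Nb}. j \<noteq> j' \<longrightarrow> zbs j \<noteq> zbs j' \<and> zbs j \<noteq> - zbs j')"

definition has_poles :: "sdata \<Rightarrow> nat \<Rightarrow> (nat \<Rightarrow> complex) \<Rightarrow> (nat \<Rightarrow> nat) \<Rightarrow>
    nat \<Rightarrow> (nat \<Rightarrow> complex) \<Rightarrow> (nat \<Rightarrow> nat) \<Rightarrow> bool" where
  "has_poles d N zs ms Nb zbs mbs \<longleftrightarrow>
     {z. 0 < cmod z \<and> cmod z < 1 \<and> tinv d z = 0} = (\<Union>j\<in>{1..N}. {zs j, - zs j}) \<and>
     (\<forall>j\<in>{1..N}. is_pole (\<lambda>w. 1 / tinv d w) (zs j) \<and> is_pole (\<lambda>w. 1 / tinv d w) (- zs j) \<and>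
        zorder (tinv d) (zs j) = int (ms j) \<and> zorder (tinv d) (- zs j) = int (ms j)) \<and>
     {z. 1 < cmod z \<and> tinvb d z = 0} = (\<Union>j\<in>{1..Nb}. {zbs j, - zbs j}) \<and>
     (\<forall>j\<in>{1..Nb}. is_pole (\<lambda>w. 1 / tinvb d w) (zbs j) \<and> is_pole (\<lambda>w. 1 / tinvb d w) (- zbs j) \<and>
        zorder (tinvb d) (zbs j) = int (mbs j) \<and> zorder (tinvb d) (- zbs j) = int (mbs j))"

definition dependency :: "sdata \<Rightarrow> nat \<Rightarrow> (nat \<Rightarrow> complex) \<Rightarrow> (nat \<Rightarrow> nat) \<Rightarrow>
    nat \<Rightarrow> (nat \<Rightarrow> complex) \<Rightarrow> (nat \<Rightarrow> nat) \<Rightarrow> bool" where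
  "dependency d N zs ms Nb zbs mbs \<longleftrightarrow>
     (\<forall>j\<in>{1..N}. \<forall>k<ms j. \<forall>n.
        (deriv ^^ k) (\<lambda>z. fst (jphi d z n)) (zs j) =
          (\<Sum>l\<le>k. of_nat (k choose l) * gam d j (k - l) * (deriv ^^ l) (\<lambda>z. fst (jpsi d z n)) (zs j)) \<and>
        (deriv ^^ k) (\<lambda>z. snd (jphi d z n)) (zs j) =
          (\<Sum>l\<le>k. of_nat (k choose l) * gam d j (k - l) * (deriv ^^ l) (\<lambda>z. snd (jpsi d z n)) (zs j))) \<and>
     (\<forall>j\<in>{1..Nb}. \<forall>k<mbs j. \<forall>n.
        (deriv ^^ k) (\<lambda>z. fst (jphib d z n)) (zbs j) =
          (\<Sum>l\<le>k. of_nat (k choose l) * gamb d j (k - l) * (deriv ^^ l) (\<lambda>z. fst (jpsib d z n)) (zbs j)) \<and>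
        (deriv ^^ k) (\<lambda>z. snd (jphib d z n)) (zbs j) =
          (\<Sum>l\<le>k. of_nat (k choose l) * gamb d j (k - l) * (deriv ^^ l) (\<lambda>z. snd (jpsib d z n)) (zbs j)))"

definition scattering_data :: "system \<Rightarrow> nat \<Rightarrow> (nat \<Rightarrow> complex) \<Rightarrow> (nat \<Rightarrow> nat) \<Rightarrow>
    nat \<Rightarrow> (nat \<Rightarrow> complex) \<Rightarrow> (nat \<Rightarrow> nat) \<Rightarrow> sdata \<Rightarrow> bool" where
  "scattering_data S N zs ms Nb zbs mbs d \<longleftrightarrow>
     jost_solutions S d \<and> transmission d \<and> has_poles d N zs ms Nb zbs mbs \<and>
     dependency d N zs ms Nb zbs mbs"

text \<open>t_{jk}: coefficient of (z - z_j)^(-k) in the Laurent expansion of T_r at z_j.\<close>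
definition tres :: "sdata \<Rightarrow> (nat \<Rightarrow> complex) \<Rightarrow> nat \<Rightarrow> nat \<Rightarrow> complex" where
  "tres d zs j k = residue (\<lambda>w. (w - zs j) ^ (k - 1) / tinv d w) (zs j)"
definition tresb :: "sdata \<Rightarrow> (nat \<Rightarrow> complex) \<Rightarrow> nat \<Rightarrow> nat \<Rightarrow> complex" where
  "tresb d zbs j k = residue (\<lambda>w. (w - zbs j) ^ (k - 1) / tinvb d w) (zbs j)"

definition norm_c :: "sdata \<Rightarrow> (nat \<Rightarrow> complex) \<Rightarrow> (nat \<Rightarrow> nat) \<Rightarrow> nat \<Rightarrow> nat \<Rightarrow> complex" where
  "norm_c d zs ms j k = - 2 * (\<Sum>l\<le>ms j - 1 - k. tres d zs j (k + 1 + l) * gam d j l / fact l)"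
definition norm_cb :: "sdata \<Rightarrow> (nat \<Rightarrow> complex) \<Rightarrow> (nat \<Rightarrow> nat) \<Rightarrow> nat \<Rightarrow> nat \<Rightarrow> complex" where
  "norm_cb d zbs mbs j k = 2 * (\<Sum>l\<le>mbs j - 1 - k. tresb d zbs j (k + 1 + l) * gamb d j l / fact l)"

definition Cblk :: "sdata \<Rightarrow> (nat \<Rightarrow> complex) \<Rightarrow> (nat \<Rightarrow> nat) \<Rightarrow> nat \<Rightarrow> complex mat" where
  "Cblk d zs ms j = mat 1 (ms j) (\<lambda>(_, i). norm_c d zs ms j (ms j - 1 - i))"
definition Cblkb :: "sdata \<Rightarrow> (nat \<Rightarrow> complex) \<Rightarrow> (nat \<Rightarrow> nat) \<Rightarrow> nat \<Rightarrow> complex mat" where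
  "Cblkb d zbs mbs j = mat 1 (mbs j) (\<lambda>(_, i). norm_cb d zbs mbs j (mbs j - 1 - i))"

definition Ablk :: "(nat \<Rightarrow> complex) \<Rightarrow> (nat \<Rightarrow> nat) \<Rightarrow> nat \<Rightarrow> complex mat" where
  "Ablk zs ms j = jordan_block (ms j) (zs j)"

fun hconcat :: "complex mat list \<Rightarrow> complex mat" where
  "hconcat [] = 0\<^sub>m 1 0"
| "hconcat (A # As) = (let B = hconcat As in
     four_block_mat A B (0\<^sub>m 0 (dim_col A)) (0\<^sub>m 0 (dim_col B)))"

definition Cfull :: "sdata \<Rightarrow> nat \<Rightarrow> (nat \<Rightarrow> complex) \<Rightarrow> (nat \<Rightarrow> nat) \<Rightarrow> complex mat" where
  "Cfull d N zs ms = hconcat (map (Cblk d zs ms) [1..<N+1])"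
definition Cfullb :: "sdata \<Rightarrow> nat \<Rightarrow> (nat \<Rightarrow> complex) \<Rightarrow> (nat \<Rightarrow> nat) \<Rightarrow> complex mat" where
  "Cfullb d N zbs mbs = hconcat (map (Cblkb d zbs mbs) [1..<N+1])"
definition Afull :: "nat \<Rightarrow> (nat \<Rightarrow> complex) \<Rightarrow> (nat \<Rightarrow> nat) \<Rightarrow> complex mat" where
  "Afull N zs ms = diag_block_mat (map (Ablk zs ms) [1..<N+1])"

definition minv :: "complex mat \<Rightarrow> complex mat" where
  "minv A = (1 / det A) \<cdot>\<^sub>m adj_mat A"

definition IminusAm2 :: "complex mat \<Rightarrow> complex mat" where
  "IminusAm2 A = 1\<^sub>m (dim_row A) - minv A * minv A"

end

theory Submission
  imports Defs
begin

text \<open>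
  If \<open>(\<alpha>, \<beta>)\<close> solves (Q), then \<open>(E\<^bsub>n-1\<^esub> \<alpha>\<^sub>n, D\<^bsub>n-1\<^esub> ((1 - z\<^sup>-\<^sup>2) \<beta>\<^sub>n - r\<^sub>n \<alpha>\<^sub>n))\<close> solves (U) with potentials
  \<open>(u, v)\<close>, and with \<open>B\<^sub>n = \<beta>\<^sub>n - r\<^sub>n \<alpha>\<^sub>n = z\<^sup>-\<^sup>1 \<beta>\<^bsub>n+1\<^esub>\<close> the pair
  \<open>(E\<^bsub>n-1\<^esub> (\<alpha>\<^sub>n + q\<^sub>n B\<^sub>n), D\<^sub>n B\<^sub>n)\<close> solves (U) with potentials \<open>(p, s)\<close>. On the unit circle Jost
  solutions are determined by their asymptotics, so these gauge maps send Jost solutions to multiples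
  of Jost solutions, with the factors \<open>E\<^sub>\<infinity>\<close>, \<open>D\<^sub>\<infinity>\<close> and \<open>1 - z\<^sup>-\<^sup>2\<close>; by Schwarz reflection the relations
  extend off the circle, and so do those between the transmission coefficients. A norming row consists
  of the polar coefficients of the transmission coefficient times the power series
  \<open>\<Sum> \<gamma>\<^sub>k (z - z\<^sub>j)\<^sup>k / k!\<close>, and right multiplication of such a row by the Jordan block is multiplication
  of the function by \<open>z\<close>. The dependency constants of the two systems can be compared because a Jost
  solution does not vanish identically at \<open>z\<^sub>j\<close>: it agrees with the one built as a uniform limit of
  polynomials on the whole disc.
\<close>

section \<open>Absolutely summable sequences and products over the integers\<close>

text \<open>The place of the factor \<open>1 - z^(-2)\<close> reflects which Jost solution it
  rescales. If \<open>phi = G psi\<close> to order \<open>m_j\<close> at \<open>z_j\<close>, the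
  gauge to \<open>(u, v)\<close> carries \<open>phi\<close> to \<open>phi\<close> but
  \<open>psi\<close> to \<open>D_inf (1 - z^(-2)) psi\<close>, so the target series \<open>G\<close>
  is that of (Q) times \<open>D_inf (1 - z^(-2))\<close>. Outside the disc \<open>phi-bar\<close>
  acquires \<open>1 - z^(-2)\<close> and \<open>psi-bar\<close> only \<open>E_inf\<close>, so the
  factor lands on the other side of the equation, whence the inverse matrix in the last formula. The
  transmission coefficients contribute \<open>1 / E_inf\<close> and \<open>1 / D_inf\<close>.
  Eliminating the data of (Q) relates \<open>(u, v)\<close> to \<open>(p, s)\<close>. All
  comparisons take place in a (U) system, whose steps on the unit circle are summable perturbations
  of unimodular diagonal ones; this gives uniqueness. Two obstacles shape the rest. The reciprocal
  transmission coefficients prescribe just one component at plus infinity, so gauged limits must be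
  drawn from that component and the recurrence. And no asymptotics are given at \<open>z_j\<close>
  itself, so nonvanishing there has to come from a construction.\<close>

abbreviation abs_summable :: "(int \<Rightarrow> complex) \<Rightarrow> bool" where
  "abs_summable f \<equiv> (\<lambda>n. norm (f n)) summable_on UNIV"

lemma tendsto_at_top_int_iff:
  "(f \<longlongrightarrow> l) (at_top :: int filter) \<longleftrightarrow> (\<lambda>k. f (int k)) \<longlonglongrightarrow> l"
proof
  assume "(f \<longlongrightarrow> l) at_top"
  then show "(\<lambda>k. f (int k)) \<longlonglongrightarrow> l"
    by (rule filterlim_compose[OF _ filterlim_int_sequentially])
next
  assume *: "(\<lambda>k. f (int k)) \<longlonglongrightarrow> l"
  have "filterlim nat at_top (at_top :: int filter)"
    unfolding filterlim_at_top
    by (metis eventually_ge_at_top eventually_mono nat_int nat_mono)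
  from filterlim_compose[OF * this] have "((\<lambda>n. f (int (nat n))) \<longlongrightarrow> l) at_top" .
  then show "(f \<longlongrightarrow> l) at_top"
    by (rule Lim_transform_eventually)
      (auto intro: eventually_mono[OF eventually_ge_at_top[of 0]])
qed

lemma tendsto_at_bot_int_iff:
  "(f \<longlongrightarrow> l) (at_bot :: int filter) \<longleftrightarrow> (\<lambda>k. f (- int k)) \<longlonglongrightarrow> l"
  unfolding at_bot_mirror filterlim_filtermap by (rule tendsto_at_top_int_iff)

lemma filterlim_add_const_int_at_top: "filterlim (\<lambda>n. n + c :: int) at_top at_top"
  unfolding filterlim_at_top
proof
  fix Z :: int
  show "\<forall>\<^sub>F x in at_top. Z \<le> x + c"
    using eventually_ge_at_top[of "Z - c"] by (rule eventually_mono) simp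
qed

lemma filterlim_add_const_int_at_bot: "filterlim (\<lambda>n. n + c :: int) at_bot at_bot"
  unfolding filterlim_at_bot
proof
  fix Z :: int
  show "\<forall>\<^sub>F x in at_bot. x + c \<le> Z"
    using eventually_le_at_bot[of "Z - c"] by (rule eventually_mono) simp
qed

lemma filterlim_diff_const_int:
  "filterlim (\<lambda>n. n - c :: int) at_top at_top" "filterlim (\<lambda>n. n - c :: int) at_bot at_bot"
  using filterlim_add_const_int_at_top[of "- c"] filterlim_add_const_int_at_bot[of "- c"] by simp_all

lemma bounded_if_tendsto_at_top_at_bot:
  fixes f :: "int \<Rightarrow> 'a :: real_normed_vector"
  assumes "(f \<longlongrightarrow> l) at_top" "(f \<longlongrightarrow> m) at_bot"
  obtains C where "\<And>n. norm (f n) \<le> C"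
proof -
  have "Bseq (\<lambda>k. f (int k))" "Bseq (\<lambda>k. f (- int k))"
    using assms by (auto intro!: convergent_imp_Bseq convergentI
        simp: tendsto_at_top_int_iff tendsto_at_bot_int_iff)
  then obtain A B where A: "\<And>k. norm (f (int k)) \<le> A" and B: "\<And>k. norm (f (- int k)) \<le> B"
    by (auto simp: Bseq_def)
  have "norm (f n) \<le> max A B" for n
  proof (cases "n \<ge> 0")
    case True
    then show ?thesis using A[of "nat n"] by simp
  next
    case False
    then show ?thesis using B[of "nat (- n)"] by simp
  qed
  then show ?thesis by (rule that)
qed

lemma summable_on_int_nat:
  fixes g :: "int \<Rightarrow> real"
  assumes "g summable_on UNIV" "\<And>n. g n \<ge> 0"
  shows "summable (\<lambda>k. g (n + int k))" "summable (\<lambda>k. g (n - int k))"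
proof -
  have "(g \<circ> (\<lambda>k. n + int k)) summable_on UNIV" "(g \<circ> (\<lambda>k. n - int k)) summable_on UNIV"
    by (subst summable_on_reindex[symmetric];
        auto intro!: injI summable_on_subset_banach[OF assms(1)])+
  then show "summable (\<lambda>k. g (n + int k))" "summable (\<lambda>k. g (n - int k))"
    using assms(2) by (auto simp: o_def summable_on_UNIV_nonneg_real_iff)
qed

lemma tendsto_zero_if_abs_summable:
  assumes "abs_summable f"
  shows "(f \<longlongrightarrow> 0) at_top" "(f \<longlongrightarrow> 0) at_bot"
  using summable_LIMSEQ_zero[OF summable_on_int_nat(1)[OF assms, of 0]]
    summable_LIMSEQ_zero[OF summable_on_int_nat(2)[OF assms, of 0]]
  by (auto simp: tendsto_at_top_int_iff tendsto_at_bot_int_iff tendsto_norm_zero_iff)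

lemma abs_summable_mult_bounded:
  fixes f g :: "int \<Rightarrow> complex"
  assumes "abs_summable f" "\<And>n. norm (g n) \<le> C"
  shows "abs_summable (\<lambda>n. f n * g n)"
proof (rule Infinite_Sum.abs_summable_on_comparison_test')
  show "(\<lambda>n. C * norm (f n)) summable_on UNIV"
    using assms(1) by (rule summable_on_cmult_right)
  show "norm (f n * g n) \<le> C * norm (f n)" for n
    using mult_right_mono[OF assms(2)[of n], of "norm (f n)"] by (simp add: norm_mult mult.commute)
qed

lemma abs_summable_shift:
  fixes f :: "int \<Rightarrow> complex"
  assumes "abs_summable f"
  shows "abs_summable (\<lambda>n. f (n + c))"
proof -
  have "((\<lambda>n. norm (f n)) \<circ> (\<lambda>n. n + c)) summable_on UNIV"
    by (subst summable_on_reindex[symmetric]) (use assms in auto)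
  then show ?thesis by (simp add: o_def)
qed

lemma rapid_decay_imp_abs_summable:
  assumes "rapid_decay f"
  shows "abs_summable f"
proof -
  have half: "summable (\<lambda>k. norm (g k))"
    if "(\<lambda>k. real k ^ 2 * norm (g k)) \<longlonglongrightarrow> 0" for g :: "nat \<Rightarrow> complex"
  proof (rule summable_comparison_test_ev)
    have "\<forall>\<^sub>F k in sequentially. real k ^ 2 * norm (g k) < 1"
      using order_tendstoD(2)[OF that, of 1] by simp
    then show "\<forall>\<^sub>F k in sequentially. norm (norm (g k)) \<le> 1 / real k ^ 2"
      using eventually_gt_at_top[of 0]
      by eventually_elim (simp add: field_simps)
    show "summable (\<lambda>k. 1 / real k ^ 2)"
      using inverse_power_summable[of 2, where 'a = real] by (simp add: field_simps)
  qed
  \<comment> \<open>Taking the exponent 2 in the decay condition makes both half-lines comparable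
    with the series of \<open>1 / k^2\<close>.\<close>
  have "summable (\<lambda>k. norm (f (int k)))" "summable (\<lambda>k. norm (f (- int k)))"
    using assms unfolding rapid_decay_def tendsto_at_top_int_iff tendsto_at_bot_int_iff
    by (auto intro!: half elim!: allE[of _ 2])
  then have "((\<lambda>n. norm (f n)) \<circ> int) summable_on UNIV"
    "((\<lambda>n. norm (f n)) \<circ> (\<lambda>k. - int k)) summable_on UNIV"
    by (auto simp: o_def summable_on_UNIV_nonneg_real_iff)
  then have "(\<lambda>n. norm (f n)) summable_on (range int \<union> range (\<lambda>k. - int k))"
    by (intro summable_on_union; subst summable_on_reindex) (auto intro: injI)
  moreover have "range int \<union> range (\<lambda>k. - int k) = UNIV"
    by (auto simp: image_iff intro: int_cases2)
  ultimately show ?thesis by simp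
qed

section \<open>Infinite products over the integers\<close>

lemma tendsto_prodinf_lessThan:
  assumes "convergent_prod (g :: nat \<Rightarrow> complex)"
  shows "(\<lambda>k. \<Prod>i<k. g i) \<longlonglongrightarrow> prodinf g"
  using convergent_prod_LIMSEQ[OF assms]
  by (subst filterlim_sequentially_Suc[symmetric]) (simp add: lessThan_Suc_atMost)

locale nonzero_product =
  fixes f :: "int \<Rightarrow> complex"
  assumes summ: "abs_summable (\<lambda>n. f n - 1)" and nz: "f n \<noteq> 0"
begin

lemma convergent_prod_right: "convergent_prod (\<lambda>k. f (n + int k))"
  and convergent_prod_left: "convergent_prod (\<lambda>k. f (n - int k))"
  using summable_on_int_nat[OF summ, of n]
  by (auto intro!: abs_convergent_prod_imp_convergent_prod simp: abs_convergent_prod_conv_summable)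

text \<open>\<open>prod_upto\<close> is defined through \<open>lim\<close>, whose value is known
  only once convergence is established; running downwards from \<open>n\<close> turns it into an
  ordinary infinite product.\<close>

lemma prod_upto_eq: "prod_upto f n = (\<Prod>k. f (n - int k))"
proof -
  have "(\<Prod>j\<in>{n - int m..n}. f j) = (\<Prod>k\<le>m. f (n - int k))" for m
    by (rule prod.reindex_bij_witness[of _ "\<lambda>k. n - int k" "\<lambda>j. nat (n - j)"]) auto
  then show ?thesis
    unfolding prod_upto_def by (simp add: limI[OF convergent_prod_LIMSEQ[OF convergent_prod_left]])
qed

lemma prod_upto_nonzero: "prod_upto f n \<noteq> 0"
  unfolding prod_upto_eq by (rule prodinf_nonzero[OF convergent_prod_left nz])

lemma prod_upto_rec: "prod_upto f n = prod_upto f (n - 1) * f n"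
  using prodinf_split_head[OF convergent_prod_left[of n]] nz[of n]
  unfolding prod_upto_eq by (simp add: algebra_simps)

lemma prod_upto_add: "prod_upto f (n + int k) = prod_upto f n * (\<Prod>i<k. f (n + 1 + int i))"
proof (induction k)
  case (Suc k)
  have "prod_upto f (n + int (Suc k)) = prod_upto f (n + int k) * f (n + 1 + int k)"
    using prod_upto_rec[of "n + int (Suc k)"] by (simp add: algebra_simps)
  with Suc show ?case by (simp add: mult.assoc)
qed simp

lemma prod_upto_diff: "prod_upto f n = prod_upto f (n - int k) * (\<Prod>i<k. f (n - int i))"
proof (induction k)
  case (Suc k)
  have "prod_upto f (n - int k) = prod_upto f (n - int (Suc k)) * f (n - int k)"
    using prod_upto_rec[of "n - int k"] by (simp add: algebra_simps)
  with Suc show ?case by (simp add: mult_ac)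
qed simp

text \<open>Dividing the product up to 0 by its last \<open>k\<close> factors leaves the product up
  to \<open>- k\<close>. The divisor tends to the same nonzero limit as the dividend, so the
  quotient tends to 1.\<close>

lemma prod_upto_at_bot: "(prod_upto f \<longlongrightarrow> 1) at_bot"
proof -
  have "(\<lambda>k. prod_upto f 0 / (\<Prod>i<k. f (0 - int i))) \<longlonglongrightarrow> prod_upto f 0 / prod_upto f 0"
    unfolding prod_upto_eq[of 0]
    by (intro tendsto_divide tendsto_const tendsto_prodinf_lessThan convergent_prod_left
        prodinf_nonzero nz)
  moreover have "prod_upto f 0 / (\<Prod>i<k. f (0 - int i)) = prod_upto f (- int k)" for k
    using prod_upto_diff[of 0 k] nz by (simp add: field_simps)
  ultimately show ?thesis using prod_upto_nonzero by (simp add: tendsto_at_bot_int_iff)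
qed

lemma prod_all_eq: "prod_all f = prod_upto f 0 * (\<Prod>k. f (1 + int k))"
proof -
  have "(\<Prod>j\<in>{- int m..int m}. f j) = (\<Prod>k\<le>m. f (0 - int k)) * (\<Prod>k<m. f (1 + int k))" for m
  proof -
    have "(\<Prod>j\<in>{- int m..int m}. f j) = (\<Prod>j\<in>{- int m..0} \<union> {1..int m}. f j)"
      by (rule arg_cong[where f = "prod f"]) auto
    also have "\<dots> = (\<Prod>j\<in>{- int m..0}. f j) * (\<Prod>j\<in>{1..int m}. f j)"
      by (rule prod.union_disjoint) auto
    also have "(\<Prod>j\<in>{- int m..0}. f j) = (\<Prod>k\<le>m. f (0 - int k))"
      by (rule prod.reindex_bij_witness[of _ "\<lambda>k. - int k" "\<lambda>j. nat (- j)"]) auto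
    also have "(\<Prod>j\<in>{1..int m}. f j) = (\<Prod>k<m. f (1 + int k))"
      by (rule prod.reindex_bij_witness[of _ "\<lambda>k. 1 + int k" "\<lambda>j. nat (j - 1)"]) auto
    finally show ?thesis .
  qed
  moreover have "(\<lambda>m. (\<Prod>k\<le>m. f (0 - int k)) * (\<Prod>k<m. f (1 + int k)))
      \<longlonglongrightarrow> (\<Prod>k. f (0 - int k)) * (\<Prod>k. f (1 + int k))"
    by (intro tendsto_mult convergent_prod_LIMSEQ tendsto_prodinf_lessThan
        convergent_prod_left convergent_prod_right)
  ultimately show ?thesis
    unfolding prod_all_def prod_upto_eq by (simp add: limI)
qed

lemma prod_upto_at_top: "(prod_upto f \<longlongrightarrow> prod_all f) at_top"
proof -
  have "(\<lambda>k. prod_upto f 0 * (\<Prod>i<k. f (1 + int i))) \<longlonglongrightarrow> prod_all f"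
    unfolding prod_all_eq
    by (intro tendsto_mult tendsto_const tendsto_prodinf_lessThan convergent_prod_right)
  then show ?thesis
    using prod_upto_add[of 0] by (simp add: tendsto_at_top_int_iff)
qed

lemma prod_all_nonzero: "prod_all f \<noteq> 0"
  unfolding prod_all_eq
  using prod_upto_nonzero prodinf_nonzero[OF convergent_prod_right nz] by simp

lemma prod_upto_bounded:
  obtains C where "\<And>n. norm (prod_upto f n) \<le> C"
  using bounded_if_tendsto_at_top_at_bot[OF prod_upto_at_top prod_upto_at_bot] by blast

text \<open>Bounds on reciprocals serve the potentials, which have \<open>D\<close> or
  \<open>E\<close> in the denominator.\<close>

lemma inverse_prod_upto_bounded:
  obtains C where "\<And>n. norm (inverse (prod_upto f n)) \<le> C"
  using bounded_if_tendsto_at_top_at_bot[OF tendsto_inverse[OF prod_upto_at_top prod_all_nonzero]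
      tendsto_inverse[OF prod_upto_at_bot]] by auto

end

section \<open>Continuation from the unit circle\<close>

text \<open>The map \<open>w\<close> to \<open>exp (i w)\<close> sends the closed upper half-plane
  onto the closed disc without 0 and the real line onto the circle, so the puncture moves to
  infinity and the boundary becomes a line. The zero boundary values are real, hence reflection
  gives an entire function vanishing on the real line.\<close>

lemma inner_ext_zero:
  assumes f: "inner_ext f" and zero: "\<And>z. cmod z = 1 \<Longrightarrow> f z = 0"
    and z: "0 < cmod z" "cmod z \<le> 1"
  shows "f z = 0"
proof -
  define g where "g = (\<lambda>w. f (exp (\<i> * w)))"
  define G where "G = (\<lambda>w. if 0 \<le> Im w then g w else cnj (g (cnj w)))"
  have "g holomorphic_on {w. 0 < Im w}"
    unfolding g_def
    by (rule holomorphic_on_compose_gen[where f = "\<lambda>w. exp (\<i> * w)" and g = f, unfolded o_def])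
      (use f in \<open>auto intro!: holomorphic_intros simp: inner_ext_def\<close>)
  moreover have "continuous_on {w. 0 \<le> Im w} g"
    unfolding g_def
    by (rule continuous_on_compose2[where f = "\<lambda>w. exp (\<i> * w)" and g = f])
      (use f in \<open>auto intro!: continuous_intros simp: inner_ext_def\<close>)
  moreover have real_zero: "g w = 0" if "w \<in> \<real>" for w
    using that zero by (auto simp: g_def elim!: Reals_cases)
  ultimately have hol: "G holomorphic_on UNIV"
    unfolding G_def by (intro Schwarz_reflection) auto
  have "G w = 0" for w
  proof (rule analytic_continuation[OF hol])
    show "(0 :: complex) islimpt \<real>"
    proof (rule islimpt_sequential[THEN iffD2], intro exI conjI allI)
      show "(\<lambda>n. complex_of_real (inverse (real (Suc n)))) \<longlonglongrightarrow> 0"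
        using tendsto_of_real[OF LIMSEQ_inverse_real_of_nat, where 'a = complex] by simp
    qed (auto simp del: of_nat_Suc)
    show "G w = 0" if "w \<in> \<real>" for w
      using that real_zero[OF that] by (auto simp: G_def complex_is_Real_iff)
  qed auto
  \<comment> \<open>The preimage of \<open>z\<close> lies in the closed upper half-plane because its
    imaginary part is \<open>- ln (cmod z)\<close>.\<close>
  moreover have "z = exp (\<i> * (- \<i> * Ln z))" "0 \<le> Im (- \<i> * Ln z)"
    using z by auto
  ultimately show ?thesis
    unfolding G_def g_def by (metis (no_types))
qed

lemma inner_ext_diff: "inner_ext f \<Longrightarrow> inner_ext g \<Longrightarrow> inner_ext (\<lambda>z. f z - g z)"
  and inner_ext_add: "inner_ext f \<Longrightarrow> inner_ext g \<Longrightarrow> inner_ext (\<lambda>z. f z + g z)"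
  and inner_ext_mult: "inner_ext f \<Longrightarrow> inner_ext g \<Longrightarrow> inner_ext (\<lambda>z. f z * g z)"
  by (auto simp: inner_ext_def intro!: holomorphic_intros continuous_intros)

lemma inner_ext_const: "inner_ext (\<lambda>z. c)"
  and inner_ext_inverse: "inner_ext (\<lambda>z. inverse z)"
  by (auto simp: inner_ext_def intro!: holomorphic_intros continuous_intros)

lemma inner_ext_eqI:
  assumes "inner_ext f" "inner_ext g" "\<And>z. cmod z = 1 \<Longrightarrow> f z = g z"
    and "0 < cmod z" "cmod z \<le> 1"
  shows "f z = g z"
  using inner_ext_zero[OF inner_ext_diff[OF assms(1,2)] _ assms(4,5)] assms(3) by simp

lemma inner_ext_uniform_limit:
  assumes lim: "uniform_limit (cball 0 1) f g sequentially"
    and hol: "\<And>k A. f k holomorphic_on A"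
  shows "inner_ext g"
  unfolding inner_ext_def
proof
  show "g holomorphic_on {z. 0 < cmod z \<and> cmod z < 1}"
  proof (rule holomorphic_on_subset[of _ "ball 0 1"])
    show "g holomorphic_on ball 0 1"
    proof (rule holomorphic_uniform_sequence[OF _ hol])
      fix z :: complex assume "z \<in> ball 0 1"
      then obtain d where "d > 0" "cball z d \<subseteq> ball 0 1"
        using open_contains_cball open_ball by metis
      then show "\<exists>d>0. cball z d \<subseteq> ball 0 1 \<and> uniform_limit (cball z d) f g sequentially"
        using uniform_limit_on_subset[OF lim] ball_subset_cball by (meson order.trans)
    qed auto
  qed auto
  have "continuous_on (cball 0 1) g"
    by (rule uniform_limit_theorem[OF _ lim])
      (auto intro!: always_eventually holomorphic_on_imp_continuous_on hol)
  then show "continuous_on {z. 0 < cmod z \<and> cmod z \<le> 1} g"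
    by (rule continuous_on_subset) auto
qed

text \<open>Inversion exchanges the punctured disc with the exterior and preserves the circle, so
  uniqueness of continuation outside follows from uniqueness inside.\<close>

lemma inner_ext_compose_inverse:
  assumes "outer_ext f"
  shows "inner_ext (\<lambda>z. f (inverse z))"
  unfolding inner_ext_def
proof
  show "(\<lambda>z. f (inverse z)) holomorphic_on {z. 0 < cmod z \<and> cmod z < 1}"
    by (rule holomorphic_on_compose_gen[where f = inverse and g = f, unfolded o_def])
      (use assms in \<open>auto intro!: holomorphic_intros simp: outer_ext_def norm_inverse one_less_inverse\<close>)
  show "continuous_on {z. 0 < cmod z \<and> cmod z \<le> 1} (\<lambda>z. f (inverse z))"
    by (rule continuous_on_compose2[where f = inverse and g = f])
      (use assms in \<open>auto intro!: continuous_intros simp: outer_ext_def norm_inverse one_le_inverse\<close>)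
qed

lemma outer_ext_diff: "outer_ext f \<Longrightarrow> outer_ext g \<Longrightarrow> outer_ext (\<lambda>z. f z - g z)"
  and outer_ext_add: "outer_ext f \<Longrightarrow> outer_ext g \<Longrightarrow> outer_ext (\<lambda>z. f z + g z)"
  and outer_ext_mult: "outer_ext f \<Longrightarrow> outer_ext g \<Longrightarrow> outer_ext (\<lambda>z. f z * g z)"
  by (auto simp: outer_ext_def intro!: holomorphic_intros continuous_intros)

lemma outer_ext_const: "outer_ext (\<lambda>z. c)"
  and outer_ext_inverse: "outer_ext (\<lambda>z. inverse z)"
  by (force simp: outer_ext_def intro!: holomorphic_intros continuous_intros)+

lemma outer_ext_eqI:
  assumes "outer_ext f" "outer_ext g" "\<And>z. cmod z = 1 \<Longrightarrow> f z = g z"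
    and "1 \<le> cmod z"
  shows "f z = g z"
proof -
  have "f (inverse (inverse z)) = g (inverse (inverse z))"
  proof (rule inner_ext_eqI[OF inner_ext_compose_inverse inner_ext_compose_inverse])
    show "0 < cmod (inverse z)" "cmod (inverse z) \<le> 1"
      using assms(4) by (auto simp: norm_inverse inverse_le_1_iff)
  qed (use assms(1-3) in \<open>simp_all add: norm_inverse\<close>)
  then show ?thesis by simp
qed

section \<open>Jost solutions of system (U)\<close>

text \<open>Iterating the bound from 0 to \<open>k\<close> costs at most the exponential of the
  total sum, uniformly in \<open>k\<close>, while \<open>d k\<close> tends to 0.\<close>

lemma gronwall_zero:
  fixes d e :: "nat \<Rightarrow> real"
  assumes d: "\<And>k. 0 \<le> d k" "\<And>k. d k \<le> exp (e k) * d (Suc k)" "d \<longlonglongrightarrow> 0"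
    and e: "summable e" "\<And>k. 0 \<le> e k"
  shows "d 0 = 0"
proof -
  have "d 0 \<le> exp (\<Sum>i<k. e i) * d k" for k
  proof (induction k)
    case (Suc k)
    also have "exp (\<Sum>i<k. e i) * d k \<le> exp (\<Sum>i<k. e i) * (exp (e k) * d (Suc k))"
      by (rule mult_left_mono) (use d in auto)
    finally show ?case by (simp add: exp_add mult_ac)
  qed simp
  also have "exp (\<Sum>i<k. e i) * d k \<le> exp (suminf e) * d k" for k
    by (intro mult_right_mono d) (use e in \<open>auto intro: sum_le_suminf\<close>)
  finally have "d 0 \<le> exp (suminf e) * d k" for k .
  moreover have "(\<lambda>k. exp (suminf e) * d k) \<longlonglongrightarrow> exp (suminf e) * 0"
    by (intro tendsto_intros d)
  ultimately have "d 0 \<le> exp (suminf e) * 0" by (intro LIMSEQ_le_const) blast+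
  with d(1)[of 0] show ?thesis by simp
qed

definition l1norm :: "complex \<times> complex \<Rightarrow> real" where
  "l1norm w = cmod (fst w) + cmod (snd w)"

lemma l1norm_nonneg [simp]: "0 \<le> l1norm w"
  by (simp add: l1norm_def)

lemma l1norm_eq_0_iff: "l1norm w = 0 \<longleftrightarrow> w = 0"
  by (auto simp: l1norm_def prod_eq_iff add_nonneg_eq_0_iff)

text \<open>In this norm a matrix is bounded by its largest column sum, here at most
  \<open>1 + cmod a + cmod b\<close>. The primed entries leave room for powers of \<open>z\<close>,
  so that one bound covers a step of (U), its adjugate and the polynomial form
  \<open>step\<close>.\<close>

lemma matrix_l1norm_bound:
  assumes "cmod c \<le> 1" "cmod d \<le> 1" "cmod a' \<le> cmod a" "cmod b' \<le> cmod b"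
  shows "l1norm (c * x + a' * y, b' * x + d * y) \<le> exp (cmod a + cmod b) * l1norm (x, y)"
proof -
  have "l1norm (c * x + a' * y, b' * x + d * y)
      \<le> (cmod c * cmod x + cmod a' * cmod y) + (cmod b' * cmod x + cmod d * cmod y)"
    unfolding l1norm_def by (auto intro!: add_mono norm_triangle_le simp: norm_mult)
  also have "\<dots> \<le> (1 * cmod x + cmod a * cmod y) + (cmod b * cmod x + 1 * cmod y)"
    by (intro add_mono mult_right_mono assms) auto
  also have "\<dots> \<le> (1 + (cmod a + cmod b)) * (cmod x + cmod y)"
    by (simp add: algebra_simps)
  also have "\<dots> \<le> exp (cmod a + cmod b) * l1norm (x, y)"
    unfolding l1norm_def by (intro mult_mono exp_ge_add_one_self) auto
  finally show ?thesis .
qed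

lemma sysU_diff: "sysU a b z n (w - w') = sysU a b z n w - sysU a b z n w'"
  by (simp add: sysU_def algebra_simps)

lemma is_sol_sysU_diff:
  "is_sol (sysU a b) z w \<Longrightarrow> is_sol (sysU a b) z w' \<Longrightarrow> is_sol (sysU a b) z (\<lambda>n. w n - w' n)"
  unfolding is_sol_def sysU_diff by metis

lemma l1norm_sysU_le:
  assumes "cmod z = 1"
  shows "l1norm (sysU a b z n w) \<le> exp (cmod (a n) + cmod (b n)) * l1norm w"
  using matrix_l1norm_bound[of z "inverse z" "z * a n" "a n" "inverse z * b n" "b n" "fst w" "snd w"]
    assms by (simp add: sysU_def norm_mult norm_inverse)

text \<open>The transfer matrix of (U) has determinant \<open>1 - a n * b n\<close> for every
  \<open>z\<close>. Its nonvanishing allows the recurrence, which runs from \<open>n + 1\<close> to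
  \<open>n\<close>, to be inverted; this is needed for normalizations at minus infinity.\<close>

locale summable_potentials =
  fixes a b :: "int \<Rightarrow> complex"
  assumes summ_a: "abs_summable a" and summ_b: "abs_summable b"
    and det_nz: "a n * b n \<noteq> 1"
begin

text \<open>The difference equals \<open>a n\<close> times \<open>b n / (1 - a n * b n)\<close>, a
  summable sequence times one that is bounded because it has limits at both ends.\<close>

lemma inverse_det_summable: "abs_summable (\<lambda>n. 1 / (1 - a n * b n) - 1)"
proof -
  have lim: "(a \<longlongrightarrow> 0) at_top" "(a \<longlongrightarrow> 0) at_bot" "(b \<longlongrightarrow> 0) at_top" "(b \<longlongrightarrow> 0) at_bot"
    by (intro tendsto_zero_if_abs_summable summ_a summ_b)+
  have "((\<lambda>n. b n / (1 - a n * b n)) \<longlongrightarrow> 0 / (1 - 0 * 0)) at_top"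
    by (rule tendsto_intros lim | simp)+
  moreover have "((\<lambda>n. b n / (1 - a n * b n)) \<longlongrightarrow> 0 / (1 - 0 * 0)) at_bot"
    by (rule tendsto_intros lim | simp)+
  ultimately obtain C where "\<And>n. norm (b n / (1 - a n * b n)) \<le> C"
    using bounded_if_tendsto_at_top_at_bot by blast
  then have "abs_summable (\<lambda>n. a n * (b n / (1 - a n * b n)))"
    by (rule abs_summable_mult_bounded[OF summ_a])
  moreover have "a n * (b n / (1 - a n * b n)) = 1 / (1 - a n * b n) - 1" for n
    using det_nz[of n] by (simp add: field_simps)
  ultimately show ?thesis by simp
qed

text \<open>The step is inverted by its adjugate divided by the determinant. The adjugate obeys the
  same bound as the step, and the scalar \<open>k\<close> is at most
  \<open>exp (cmod (k - 1))\<close>, whose exponent is summable.\<close>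

lemma l1norm_sysU_ge:
  assumes "cmod z = 1"
  shows "l1norm w \<le> exp (cmod (a n) + cmod (b n) + cmod (1 / (1 - a n * b n) - 1)) *
    l1norm (sysU a b z n w)"
proof -
  define k where "k = 1 / (1 - a n * b n)"
  define v where "v = sysU a b z n w"
  have z: "z \<noteq> 0" using assms by auto
  have k: "k * (1 - a n * b n) = 1" using det_nz[of n] by (simp add: k_def)
  have "k * (inverse z * fst v + (- z * a n) * snd v) = k * (1 - a n * b n) * fst w"
    "k * ((- inverse z * b n) * fst v + z * snd v) = k * (1 - a n * b n) * snd w"
    using z by (simp_all add: v_def sysU_def field_simps)
  then have w: "w = (k * (inverse z * fst v + (- z * a n) * snd v),
      k * ((- inverse z * b n) * fst v + z * snd v))"
    unfolding k by (simp add: prod_eq_iff)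
  have "l1norm w = cmod k * l1norm (inverse z * fst v + (- z * a n) * snd v,
      (- inverse z * b n) * fst v + z * snd v)"
    by (subst w) (simp only: l1norm_def norm_mult fst_conv snd_conv distrib_left[of "cmod k"])
  also have "\<dots> \<le> cmod k * (exp (cmod (a n) + cmod (b n)) * l1norm (fst v, snd v))"
    using assms by (intro mult_left_mono matrix_l1norm_bound) (auto simp: norm_mult norm_inverse)
  also have "\<dots> \<le> exp (cmod (k - 1)) * (exp (cmod (a n) + cmod (b n)) * l1norm (fst v, snd v))"
  proof (rule mult_right_mono)
    have "cmod k \<le> 1 + cmod (k - 1)"
      using norm_triangle_ineq[of 1 "k - 1"] by simp
    then show "cmod k \<le> exp (cmod (k - 1))"
      using exp_ge_add_one_self[of "cmod (k - 1)"] by (rule order.trans)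
  qed simp
  finally show ?thesis
    by (simp add: v_def k_def exp_add mult_ac)
qed

lemma sol_zero_at_top:
  assumes z: "cmod z = 1" and sol: "is_sol (sysU a b) z w"
    and lim: "((\<lambda>n. fst (w n)) \<longlongrightarrow> 0) at_top" "((\<lambda>n. snd (w n)) \<longlongrightarrow> 0) at_top"
  shows "w n = 0"
proof -
  have "l1norm (w (n + int 0)) = 0"
  proof (rule gronwall_zero[where d = "\<lambda>k. l1norm (w (n + int k))" and
        e = "\<lambda>k. cmod (a (n + int k)) + cmod (b (n + int k))"])
    fix k :: nat
    have "w (n + int k) = sysU a b z (n + int k) (w (n + int (Suc k)))"
      using sol[unfolded is_sol_def, rule_format, of "n + int k"] by (simp add: algebra_simps)
    then show "l1norm (w (n + int k)) \<le>
        exp (cmod (a (n + int k)) + cmod (b (n + int k))) * l1norm (w (n + int (Suc k)))"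
      using l1norm_sysU_le[OF z, of a b "n + int k" "w (n + int (Suc k))"] by simp
  next
    have "((\<lambda>m. l1norm (w (m + n))) \<longlongrightarrow> cmod 0 + cmod 0) at_top"
      unfolding l1norm_def
      by (intro tendsto_intros filterlim_compose[OF lim(1) filterlim_add_const_int_at_top]
          filterlim_compose[OF lim(2) filterlim_add_const_int_at_top])
    then show "(\<lambda>k. l1norm (w (n + int k))) \<longlonglongrightarrow> 0"
      by (simp add: tendsto_at_top_int_iff add.commute)
    show "summable (\<lambda>k. cmod (a (n + int k)) + cmod (b (n + int k)))"
      by (intro summable_add summable_on_int_nat[OF summ_a] summable_on_int_nat[OF summ_b]) auto
  qed auto
  then show ?thesis by (simp add: l1norm_eq_0_iff)
qed

lemma sol_zero_at_bot:
  assumes z: "cmod z = 1" and sol: "is_sol (sysU a b) z w"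
    and lim: "((\<lambda>n. fst (w n)) \<longlongrightarrow> 0) at_bot" "((\<lambda>n. snd (w n)) \<longlongrightarrow> 0) at_bot"
  shows "w n = 0"
proof -
  define e where "e = (\<lambda>n. cmod (a n) + cmod (b n) + cmod (1 / (1 - a n * b n) - 1))"
  have "l1norm (w (n - int 0)) = 0"
  proof (rule gronwall_zero[where d = "\<lambda>k. l1norm (w (n - int k))" and
        e = "\<lambda>k. e (n - 1 - int k)"])
    fix k :: nat
    have "w (n - 1 - int k) = sysU a b z (n - 1 - int k) (w (n - int k))"
      using sol[unfolded is_sol_def, rule_format, of "n - 1 - int k"] by (simp add: algebra_simps)
    then show "l1norm (w (n - int k)) \<le> exp (e (n - 1 - int k)) * l1norm (w (n - int (Suc k)))"
      using l1norm_sysU_ge[OF z, of "w (n - int k)" "n - 1 - int k"]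
      by (simp add: e_def algebra_simps)
  next
    have "((\<lambda>m. l1norm (w (m + n))) \<longlongrightarrow> cmod 0 + cmod 0) at_bot"
      unfolding l1norm_def
      by (intro tendsto_intros filterlim_compose[OF lim(1) filterlim_add_const_int_at_bot]
          filterlim_compose[OF lim(2) filterlim_add_const_int_at_bot])
    then show "(\<lambda>k. l1norm (w (n - int k))) \<longlonglongrightarrow> 0"
      by (simp add: tendsto_at_bot_int_iff add.commute)
    show "summable (\<lambda>k. e (n - 1 - int k))"
      unfolding e_def
      by (intro summable_add summable_on_int_nat[OF summ_a] summable_on_int_nat[OF summ_b]
          summable_on_int_nat[OF inverse_det_summable]) auto
  qed (auto simp: e_def)
  then show ?thesis by (simp add: l1norm_eq_0_iff)
qed

end

text \<open>Neither \<open>f\<close> nor \<open>g\<close> need converge, but a unimodular factor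
  does not change the modulus of their difference.\<close>

lemma tendsto_diff_phase:
  fixes f g c :: "int \<Rightarrow> complex"
  assumes "((\<lambda>n. f n * c n) \<longlongrightarrow> A) F" "((\<lambda>n. g n * c n) \<longlongrightarrow> A) F" "\<And>n. cmod (c n) = 1"
  shows "((\<lambda>n. f n - g n) \<longlongrightarrow> 0) F"
proof -
  have "((\<lambda>n. f n * c n - g n * c n) \<longlongrightarrow> A - A) F"
    by (intro tendsto_diff assms)
  then have "((\<lambda>n. cmod (f n * c n - g n * c n)) \<longlongrightarrow> 0) F"
    by (simp add: tendsto_norm_zero)
  also have "(\<lambda>n. cmod (f n * c n - g n * c n)) = (\<lambda>n. cmod (f n - g n))"
    using assms(3) by (simp add: norm_mult flip: left_diff_distrib)
  finally show ?thesis by (rule tendsto_norm_zero_cancel)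
qed

lemma norm_powi_eq_1: "cmod z = 1 \<Longrightarrow> cmod (z powi n) = 1"
  by (simp add: norm_power_int)

text \<open>This encodes \<open>w n ~ (fst c * z^(-n), snd c * z^n)\<close>. On the unit circle an
  entry 0 of \<open>c\<close> expresses an \<open>o(1)\<close> component, so all four Jost
  normalizations are instances.\<close>

definition jost_limit :: "complex \<Rightarrow> (int \<Rightarrow> complex \<times> complex) \<Rightarrow> complex \<times> complex \<Rightarrow> int filter \<Rightarrow> bool"
  where "jost_limit z w c F \<longleftrightarrow> ((\<lambda>n. fst (w n) * z powi n) \<longlongrightarrow> fst c) F \<and>
    ((\<lambda>n. snd (w n) * z powi (- n)) \<longlongrightarrow> snd c) F"

context summable_potentials
begin

text \<open>By linearity the difference is a solution; it tends to 0 at one end of the integers, and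
  Gronwall propagates this to every \<open>n\<close>.\<close>

lemma sol_eq_if_jost_limit:
  assumes z: "cmod z = 1" and sol: "is_sol (sysU a b) z w" "is_sol (sysU a b) z w'"
    and lim: "jost_limit z w c F" "jost_limit z w' c F" and F: "F = at_top \<or> F = at_bot"
  shows "w n = w' n"
proof -
  have "((\<lambda>n. fst (w n) - fst (w' n)) \<longlongrightarrow> 0) F"
    by (rule tendsto_diff_phase[where c = "\<lambda>n. z powi n" and A = "fst c"])
      (use lim norm_powi_eq_1[OF z] in \<open>simp_all add: jost_limit_def\<close>)
  moreover have "((\<lambda>n. snd (w n) - snd (w' n)) \<longlongrightarrow> 0) F"
    by (rule tendsto_diff_phase[where c = "\<lambda>n. z powi (- n)" and A = "snd c"])
      (use lim norm_powi_eq_1[OF z] in \<open>simp_all only: jost_limit_def\<close>)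
  ultimately have "((\<lambda>n. fst (w n - w' n)) \<longlongrightarrow> 0) F" "((\<lambda>n. snd (w n - w' n)) \<longlongrightarrow> 0) F"
    by simp_all
  then have "w n - w' n = 0"
    using F sol_zero_at_top[OF z is_sol_sysU_diff[OF sol]] sol_zero_at_bot[OF z is_sol_sysU_diff[OF sol]]
    by blast
  then show ?thesis by simp
qed

end

section \<open>Construction of the Jost solution on the whole disc\<close>

lemma sum_le_total:
  fixes g :: "int \<Rightarrow> real"
  assumes "g summable_on UNIV" "\<And>n. g n \<ge> 0"
  shows "(\<Sum>i<k. g (n + int i)) \<le> infsum g UNIV"
proof -
  have "(\<Sum>i<k. g (n + int i)) = sum g ((\<lambda>i. n + int i) ` {..<k})"
    by (subst sum.reindex) (auto simp: inj_on_def)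
  also have "\<dots> \<le> infsum g UNIV"
    by (rule finite_sum_le_infsum) (use assms in auto)
  finally show ?thesis .
qed

lemma suminf_tail_at_top:
  fixes g :: "int \<Rightarrow> real"
  assumes "g summable_on UNIV" "\<And>n. g n \<ge> 0"
  shows "((\<lambda>n. \<Sum>k. g (n + int k)) \<longlongrightarrow> 0) at_top"
proof -
  define h where "h = (\<lambda>k. g (int k))"
  have h: "summable h"
    using summable_on_int_nat(1)[OF assms, of 0] by (simp add: h_def)
  have "(\<lambda>m. suminf h - (\<Sum>i<m. h i)) \<longlonglongrightarrow> suminf h - suminf h"
    by (intro tendsto_intros summable_LIMSEQ h)
  moreover have "suminf h - (\<Sum>i<m. h i) = (\<Sum>k. g (int m + int k))" for m
    using suminf_minus_initial_segment[OF h, of m] by (simp add: h_def add.commute)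
  ultimately show ?thesis by (simp add: tendsto_at_top_int_iff)
qed

text \<open>Weierstrass test for the telescoping series. The distance to the initial term is
  recorded because, with tails of a summable sequence as majorants, it yields the asymptotics in
  \<open>n\<close>.\<close>

lemma uniform_limit_telescope:
  fixes f :: "nat \<Rightarrow> 'a \<Rightarrow> complex"
  assumes le: "\<And>k x. x \<in> A \<Longrightarrow> cmod (f (Suc k) x - f k x) \<le> M k" and M: "summable M"
  shows "uniform_limit A f (\<lambda>x. lim (\<lambda>k. f k x)) sequentially"
    and "x \<in> A \<Longrightarrow> cmod (lim (\<lambda>k. f k x) - f 0 x) \<le> suminf M"
proof -
  have f_eq: "f 0 x + (\<Sum>i<k. f (Suc i) x - f i x) = f k x" for k x
    using sum_lessThan_telescope[of "\<lambda>i. f i x" k] by simp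
  have "uniform_limit A (\<lambda>n x. \<Sum>i<n. f (Suc i) x - f i x) (\<lambda>x. \<Sum>i. f (Suc i) x - f i x) sequentially"
    by (rule Weierstrass_m_test) (use assms in auto)
  from uniform_limit_add[OF uniform_limit_const this, of "f 0"]
  have *: "uniform_limit A f (\<lambda>x. f 0 x + (\<Sum>i. f (Suc i) x - f i x)) sequentially"
    by (simp add: f_eq)
  have lim: "lim (\<lambda>k. f k x) = f 0 x + (\<Sum>i. f (Suc i) x - f i x)" if "x \<in> A" for x
    by (rule limI[OF tendsto_uniform_limitI[OF * that]])
  show "uniform_limit A f (\<lambda>x. lim (\<lambda>k. f k x)) sequentially"
    using * by (rule uniform_limit_cong'[THEN iffD1, rotated 2]) (auto simp: lim)
  assume x: "x \<in> A"
  have s: "summable (\<lambda>i. cmod (f (Suc i) x - f i x))"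
    by (rule summable_comparison_test'[OF M]) (use le x in auto)
  have "cmod (lim (\<lambda>k. f k x) - f 0 x) = cmod (\<Sum>i. f (Suc i) x - f i x)"
    by (simp add: lim x)
  also have "\<dots> \<le> (\<Sum>i. cmod (f (Suc i) x - f i x))"
    by (rule summable_norm[OF s])
  also have "\<dots> \<le> suminf M"
    by (intro suminf_le le x s M)
  finally show "cmod (lim (\<lambda>k. f k x) - f 0 x) \<le> suminf M" .
qed

context summable_potentials
begin

text \<open>After the substitution \<open>w n = (z ^ n * X n, z ^ n * Y n)\<close> the system becomes polynomial in
  \<open>z\<close>; \<open>approx k n z\<close> is the value at \<open>n\<close> of its solution with data \<open>(0, 1)\<close> at \<open>n + k\<close>.\<close>

definition step :: "complex \<Rightarrow> int \<Rightarrow> complex \<times> complex \<Rightarrow> complex \<times> complex" where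
  "step z n p = (z\<^sup>2 * fst p + (z\<^sup>2 * a n) * snd p, b n * fst p + 1 * snd p)"

primrec approx :: "nat \<Rightarrow> int \<Rightarrow> complex \<Rightarrow> complex \<times> complex" where
  "approx 0 n z = (0, 1)"
| "approx (Suc k) n z = step z n (approx k (n + 1) z)"

definition total :: real where
  "total = infsum (\<lambda>n. cmod (a n) + cmod (b n)) UNIV"

lemma pot_summable: "(\<lambda>n. cmod (a n) + cmod (b n)) summable_on UNIV"
  by (intro summable_on_add summ_a summ_b)

text \<open>After the substitution only nonnegative powers of \<open>z\<close> remain, so the bound
  extends from the circle to the closed disc.\<close>

lemma l1norm_step_le:
  assumes "cmod z \<le> 1"
  shows "l1norm (step z n p) \<le> exp (cmod (a n) + cmod (b n)) * l1norm p"
  unfolding step_def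
  using matrix_l1norm_bound[of "z\<^sup>2" 1 "z\<^sup>2 * a n" "a n" "b n" "b n" "fst p" "snd p"] assms
  by (simp add: norm_mult norm_power power_le_one mult_left_le_one_le)

lemma step_diff: "step z n (p - p') = step z n p - step z n p'"
  by (simp add: step_def algebra_simps)

text \<open>Both approximants arise by the same \<open>k\<close> steps from data at
  \<open>n + k\<close> that differ by \<open>(z^2 * a (n + k), 0)\<close>, since one step maps
  \<open>(0, 1)\<close> to \<open>(z^2 * a (n + k), 1)\<close>. The exponential bounds the
  amplification by these steps.\<close>

lemma approx_diff_le_aux:
  assumes "cmod z \<le> 1"
  shows "l1norm (approx (Suc k) n z - approx k n z) \<le>
    exp (\<Sum>i<k. cmod (a (n + int i)) + cmod (b (n + int i))) * cmod (a (n + int k))"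
proof (induction k arbitrary: n)
  case 0
  show ?case
    using assms by (simp add: l1norm_def step_def norm_mult norm_power power_le_one mult_left_le_one_le)
next
  case (Suc k)
  have "l1norm (approx (Suc (Suc k)) n z - approx (Suc k) n z) =
      l1norm (step z n (approx (Suc k) (n + 1) z - approx k (n + 1) z))"
    by (simp add: step_diff)
  also have "\<dots> \<le> exp (cmod (a n) + cmod (b n)) *
      l1norm (approx (Suc k) (n + 1) z - approx k (n + 1) z)"
    by (rule l1norm_step_le[OF assms])
  also have "\<dots> \<le> exp (cmod (a n) + cmod (b n)) *
      (exp (\<Sum>i<k. cmod (a (n + 1 + int i)) + cmod (b (n + 1 + int i))) * cmod (a (n + 1 + int k)))"
    by (intro mult_left_mono Suc) auto
  also have "\<dots> = exp (\<Sum>i<Suc k. cmod (a (n + int i)) + cmod (b (n + int i))) *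
      cmod (a (n + int (Suc k)))"
    by (subst sum.lessThan_Suc_shift) (simp add: exp_add mult.assoc add.assoc add.commute[of 1])
  finally show ?case .
qed

lemma approx_diff_le:
  assumes "cmod z \<le> 1"
  shows "l1norm (approx (Suc k) n z - approx k n z) \<le> exp total * cmod (a (n + int k))"
  unfolding total_def
  by (rule order.trans[OF approx_diff_le_aux[OF assms]])
    (intro mult_right_mono exp_mono sum_le_total[OF pot_summable], auto)

definition jostX :: "int \<Rightarrow> complex \<Rightarrow> complex" where
  "jostX n z = lim (\<lambda>k. fst (approx k n z))"

definition jostY :: "int \<Rightarrow> complex \<Rightarrow> complex" where
  "jostY n z = lim (\<lambda>k. snd (approx k n z))"

lemma summable_bound: "summable (\<lambda>k. exp total * cmod (a (n + int k)))"
  by (intro summable_mult summable_on_int_nat[OF summ_a]) auto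

lemma approx_uniform_limit:
  "uniform_limit (cball 0 1) (\<lambda>k z. fst (approx k n z)) (jostX n) sequentially"
  "uniform_limit (cball 0 1) (\<lambda>k z. snd (approx k n z)) (jostY n) sequentially"
  and jost_bound:
  "cmod z \<le> 1 \<Longrightarrow> cmod (jostX n z) \<le> exp total * (\<Sum>k. cmod (a (n + int k)))"
  "cmod z \<le> 1 \<Longrightarrow> cmod (jostY n z - 1) \<le> exp total * (\<Sum>k. cmod (a (n + int k)))"
proof -
  have s: "suminf (\<lambda>k. exp total * cmod (a (n + int k))) = exp total * (\<Sum>k. cmod (a (n + int k)))"
    by (intro suminf_mult summable_on_int_nat[OF summ_a]) auto
  have le: "cmod (fst (approx (Suc k) n z) - fst (approx k n z)) \<le> exp total * cmod (a (n + int k))"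
    "cmod (snd (approx (Suc k) n z) - snd (approx k n z)) \<le> exp total * cmod (a (n + int k))"
    if "z \<in> cball 0 1" for k z
    using approx_diff_le[of z k n] that by (auto simp: l1norm_def intro: order.trans[rotated])
  note X = uniform_limit_telescope[where f = "\<lambda>k z. fst (approx k n z)" and A = "cball 0 1",
      OF le(1) summable_bound]
  note Y = uniform_limit_telescope[where f = "\<lambda>k z. snd (approx k n z)" and A = "cball 0 1",
      OF le(2) summable_bound]
  show "uniform_limit (cball 0 1) (\<lambda>k z. fst (approx k n z)) (jostX n) sequentially"
    "uniform_limit (cball 0 1) (\<lambda>k z. snd (approx k n z)) (jostY n) sequentially"
    using X(1) Y(1) by (simp_all add: jostX_def[abs_def] jostY_def[abs_def])
  assume "cmod z \<le> 1"
  then show "cmod (jostX n z) \<le> exp total * (\<Sum>k. cmod (a (n + int k)))"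
    "cmod (jostY n z - 1) \<le> exp total * (\<Sum>k. cmod (a (n + int k)))"
    using X(2)[of z] Y(2)[of z] by (simp_all add: jostX_def jostY_def s)
qed

lemma approx_holomorphic:
  "(\<lambda>z. fst (approx k n z)) holomorphic_on A" "(\<lambda>z. snd (approx k n z)) holomorphic_on A"
  by (induction k arbitrary: n) (auto simp: step_def intro!: holomorphic_intros)

lemma inner_ext_jost: "inner_ext (jostX n)" "inner_ext (jostY n)"
  by (rule inner_ext_uniform_limit[OF approx_uniform_limit(1) approx_holomorphic(1)]
      inner_ext_uniform_limit[OF approx_uniform_limit(2) approx_holomorphic(2)])+

lemma jost_step:
  assumes "cmod z \<le> 1"
  shows "(jostX n z, jostY n z) = step z n (jostX (n + 1) z, jostY (n + 1) z)"
proof -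
  have lim: "(\<lambda>k. fst (approx k n z)) \<longlonglongrightarrow> jostX n z" "(\<lambda>k. snd (approx k n z)) \<longlonglongrightarrow> jostY n z" for n
    using assms by (auto intro: tendsto_uniform_limitI approx_uniform_limit)
  have "(\<lambda>k. fst (approx (Suc k) n z)) \<longlonglongrightarrow> fst (step z n (jostX (n + 1) z, jostY (n + 1) z))"
    "(\<lambda>k. snd (approx (Suc k) n z)) \<longlonglongrightarrow> snd (step z n (jostX (n + 1) z, jostY (n + 1) z))"
    by (auto simp: step_def intro!: tendsto_intros lim)
  moreover have "(\<lambda>k. fst (approx (Suc k) n z)) \<longlonglongrightarrow> jostX n z"
    "(\<lambda>k. snd (approx (Suc k) n z)) \<longlonglongrightarrow> jostY n z"
    using LIMSEQ_Suc[OF lim(1)] LIMSEQ_Suc[OF lim(2)] .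
  ultimately show ?thesis
    by (auto simp: prod_eq_iff intro: LIMSEQ_unique)
qed

lemma jost_is_sol:
  assumes "cmod z \<le> 1" "z \<noteq> 0"
  shows "is_sol (sysU a b) z (\<lambda>n. (z powi n * jostX n z, z powi n * jostY n z))"
  unfolding is_sol_def
proof
  fix n
  have "jostX n z = z\<^sup>2 * jostX (n + 1) z + z\<^sup>2 * a n * jostY (n + 1) z"
    "jostY n z = b n * jostX (n + 1) z + jostY (n + 1) z"
    using jost_step[OF assms(1), of n] by (simp_all add: step_def)
  then show "(z powi n * jostX n z, z powi n * jostY n z) =
      sysU a b z n (z powi (n + 1) * jostX (n + 1) z, z powi (n + 1) * jostY (n + 1) z)"
    using assms(2) by (simp add: sysU_def power_int_add field_simps power2_eq_square)
qed

lemma jost_at_top: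
  assumes "cmod z \<le> 1"
  shows "((\<lambda>n. jostX n z) \<longlongrightarrow> 0) at_top" "((\<lambda>n. jostY n z) \<longlongrightarrow> 1) at_top"
proof -
  have "((\<lambda>n. exp total * (\<Sum>k. cmod (a (n + int k)))) \<longlongrightarrow> exp total * 0) at_top"
    by (intro tendsto_intros suminf_tail_at_top summ_a) auto
  then have lim: "((\<lambda>n. exp total * (\<Sum>k. cmod (a (n + int k)))) \<longlongrightarrow> 0) at_top" by simp
  show "((\<lambda>n. jostX n z) \<longlongrightarrow> 0) at_top"
    by (rule Lim_null_comparison[OF _ lim]) (use jost_bound[OF assms] in auto)
  have "((\<lambda>n. jostY n z - 1) \<longlongrightarrow> 0) at_top"
    by (rule Lim_null_comparison[OF _ lim]) (use jost_bound[OF assms] in auto)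
  then show "((\<lambda>n. jostY n z) \<longlongrightarrow> 1) at_top" by (simp add: LIM_zero_iff)
qed

text \<open>The asymptotics prescribed on the unit circle determine the Jost solution in the whole
  punctured disc, so it inherits the asymptotics of the explicitly constructed one.\<close>

lemma inner_jost_nonzero:
  assumes ext: "\<And>n. inner_ext (\<lambda>z. snd (w z n))"
    and sol: "\<And>z. cmod z = 1 \<Longrightarrow> is_sol (sysU a b) z (w z)"
    and lim: "\<And>z. cmod z = 1 \<Longrightarrow> jost_limit z (w z) (0, 1) at_top"
    and z0: "0 < cmod z0" "cmod z0 < 1"
  obtains n where "snd (w z0 n) \<noteq> 0"
proof -
  have circle: "snd (w z n) = z powi n * jostY n z" if z: "cmod z = 1" for z n
  proof -
    define J where "J = (\<lambda>n. (z powi n * jostX n z, z powi n * jostY n z))"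
    have z': "cmod z \<le> 1" "z \<noteq> 0" using z by auto
    have "((\<lambda>n. cmod (jostX n z)) \<longlongrightarrow> 0) at_top"
      using jost_at_top(1)[OF z'(1)] by (rule tendsto_norm_zero)
    moreover have "cmod (fst (J n) * z powi n) = cmod (jostX n z)" for n
      by (simp add: J_def norm_mult norm_powi_eq_1[OF z])
    ultimately have "((\<lambda>n. fst (J n) * z powi n) \<longlongrightarrow> 0) at_top"
      by (simp only: tendsto_norm_zero_iff[of "\<lambda>n. fst (J n) * z powi n", symmetric])
    moreover have "snd (J n) * z powi (- n) = jostY n z" for n
      using z' by (simp add: J_def power_int_minus)
    ultimately have "jost_limit z J (0, 1) at_top"
      using jost_at_top(2)[OF z'(1)] by (simp only: jost_limit_def fst_conv snd_conv simp_thms)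
    moreover have "is_sol (sysU a b) z J"
      unfolding J_def by (rule jost_is_sol[OF z'])
    ultimately have "w z n = J n"
      by (intro sol_eq_if_jost_limit[OF z sol[OF z] _ lim[OF z]]) simp_all
    then show ?thesis by (simp add: J_def)
  qed
  have "snd (w z0 n) = z0 powi n * jostY n z0" for n
  proof (rule inner_ext_eqI[where f = "\<lambda>z. snd (w z n)" and g = "\<lambda>z. z powi n * jostY n z"])
    show "inner_ext (\<lambda>z. z powi n * jostY n z)"
      by (intro inner_ext_mult inner_ext_jost)
        (auto simp: inner_ext_def intro!: holomorphic_intros continuous_intros)
  qed (use z0 ext circle in auto)
  \<comment> \<open>For the constructed solution the limit 1 holds at every point of the closed
    disc, hence also at the interior point \<open>z0\<close>.\<close>
  moreover have "\<forall>\<^sub>F n in at_top. jostY n z0 \<noteq> 0"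
    using z0 by (intro tendsto_imp_eventually_ne[OF jost_at_top(2)]) auto
  then obtain n where "jostY n z0 \<noteq> 0"
    unfolding eventually_at_top_linorder by blast
  ultimately have "snd (w z0 n) \<noteq> 0"
    using z0 by simp
  then show ?thesis by (rule that)
qed

end

section \<open>Taylor expansions and dependency constants\<close>

text \<open>Identities between the derivatives of order below \<open>m\<close> become congruences
  modulo \<open>fps_X ^ m\<close>, to which ring arithmetic applies.\<close>

lemma fps_X_power_dvd_iff: "fps_X ^ m dvd F \<longleftrightarrow> (\<forall>k<m. fps_nth F k = 0)"
  for F :: "complex fps"
proof
  assume "fps_X ^ m dvd F"
  then show "\<forall>k<m. fps_nth F k = 0"
    by (auto elim!: dvdE simp: fps_X_power_mult_nth)
next
  assume *: "\<forall>k<m. fps_nth F k = 0"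
  show "fps_X ^ m dvd F"
  proof (cases "F = 0")
    case False
    then have "m \<le> subdegree F"
      using * by (intro subdegree_geI) auto
    then show ?thesis using False by (simp add: fps_dvd_iff)
  qed simp
qed

lemma fps_expansion_mult:
  assumes "f analytic_on {z}" "g analytic_on {z}"
  shows "fps_expansion (\<lambda>w. f w * g w) z = fps_expansion f z * fps_expansion g z"
proof (rule fps_ext)
  fix n
  have "fps_nth (fps_expansion (\<lambda>w. f w * g w) z) n =
      (\<Sum>i=0..n. of_nat (n choose i) * (deriv ^^ i) f z * (deriv ^^ (n - i)) g z) / fact n"
    by (simp add: fps_expansion_def higher_deriv_mult_at[OF assms])
  also have "\<dots> = (\<Sum>i=0..n. (deriv ^^ i) f z / fact i * ((deriv ^^ (n - i)) g z / fact (n - i)))"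
    by (simp add: sum_divide_distrib binomial_fact field_simps)
  finally show "fps_nth (fps_expansion (\<lambda>w. f w * g w) z) n =
      fps_nth (fps_expansion f z * fps_expansion g z) n"
    by (simp add: fps_mult_nth fps_expansion_def)
qed

lemma fps_expansion_add:
  assumes "f analytic_on {z}" "g analytic_on {z}"
  shows "fps_expansion (\<lambda>w. f w + g w) z = fps_expansion f z + fps_expansion g z"
  by (rule fps_ext) (simp add: fps_expansion_def higher_deriv_add_at[OF assms] add_divide_distrib)

lemma fps_expansion_minus:
  assumes "f analytic_on {z}" "g analytic_on {z}"
  shows "fps_expansion (\<lambda>w. f w - g w) z = fps_expansion f z - fps_expansion g z"
  by (rule fps_ext) (simp add: fps_expansion_def higher_deriv_diff_at[OF assms] diff_divide_distrib)

lemma fps_expansion_const [simp]: "fps_expansion (\<lambda>w. c) z = fps_const c"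
  by (rule fps_ext) (simp add: fps_expansion_def)

lemma fps_expansion_ident [simp]: "fps_expansion (\<lambda>w. w) z = fps_const z + fps_X"
proof (rule fps_ext)
  fix n
  show "fps_nth (fps_expansion (\<lambda>w. w) z) n = fps_nth (fps_const z + fps_X) n"
    by (cases n) (auto simp: fps_expansion_def fps_X_def higher_deriv_id)
qed

lemma fps_expansion_inverse_ident:
  assumes "z \<noteq> 0"
  shows "fps_expansion inverse z = inverse (fps_const z + fps_X)"
proof -
  have "inverse analytic_on {z}"
    using assms by (auto intro!: analytic_intros)
  then have "fps_expansion inverse z * (fps_const z + fps_X) = fps_expansion (\<lambda>w. inverse w * w) z"
    by (subst fps_expansion_mult) (auto intro!: analytic_intros)
  also have "\<dots> = fps_expansion (\<lambda>w. 1) z"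
  proof (rule fps_expansion_cong)
    have "\<forall>\<^sub>F w in nhds z. w \<noteq> 0"
      using assms by (intro t1_space_nhds) auto
    then show "\<forall>\<^sub>F w in nhds z. inverse w * w = 1"
      by eventually_elim simp
  qed
  finally show ?thesis
    using fps_inverse_unique[of "fps_const z + fps_X" "fps_expansion inverse z"]
    by (simp add: mult.commute)
qed

text \<open>The defining relations of the dependency constants are the Leibniz rule for a product of
  \<open>\<psi>\<close> with the series having derivatives \<open>g k\<close>, valid to order
  \<open>m\<close>.\<close>

lemma gamma_dvd:
  assumes "\<forall>k<m. (deriv ^^ k) \<phi> z = (\<Sum>l\<le>k. of_nat (k choose l) * g (k - l) * (deriv ^^ l) \<psi> z)"
  shows "fps_X ^ m dvd fps_expansion \<phi> z - Abs_fps (\<lambda>k. g k / fact k) * fps_expansion \<psi> z"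
proof -
  have "fps_nth (fps_expansion \<phi> z) k =
      fps_nth (fps_expansion \<psi> z * Abs_fps (\<lambda>k. g k / fact k)) k" if "k < m" for k
  proof -
    have "fps_nth (fps_expansion \<phi> z) k =
        (\<Sum>l\<le>k. of_nat (k choose l) * g (k - l) * (deriv ^^ l) \<psi> z) / fact k"
      using assms that by (simp add: fps_expansion_def)
    also have "\<dots> = (\<Sum>l=0..k. (deriv ^^ l) \<psi> z / fact l * (g (k - l) / fact (k - l)))"
      by (simp add: sum_divide_distrib binomial_fact field_simps atMost_atLeast0)
    finally show ?thesis by (simp add: fps_mult_nth fps_expansion_def)
  qed
  then show ?thesis by (simp add: fps_X_power_dvd_iff mult.commute)
qed

text \<open>Applying the same linear combination \<open>A\<close>, \<open>B\<close> to the
  congruences of the source makes \<open>P\<close> divide the claimed difference times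
  \<open>\<Psi>2\<close>. A nonzero constant term makes \<open>\<Psi>2\<close> a unit, so it can be
  cancelled.\<close>

lemma gamma_unique:
  fixes H1 H2 A B \<Gamma>1 \<Gamma>2 :: "complex fps"
  assumes "H1 * \<Phi>2 = A * \<Phi>a + B * \<Phi>b" "H2 * \<Psi>2 = A * \<Psi>a + B * \<Psi>b"
    and d: "P dvd \<Phi>a - \<Gamma>1 * \<Psi>a" "P dvd \<Phi>b - \<Gamma>1 * \<Psi>b" "P dvd \<Phi>2 - \<Gamma>2 * \<Psi>2"
    and nz: "fps_nth \<Psi>2 0 \<noteq> 0"
  shows "P dvd H1 * \<Gamma>2 - H2 * \<Gamma>1"
proof -
  have "P dvd A * (\<Phi>a - \<Gamma>1 * \<Psi>a) + B * (\<Phi>b - \<Gamma>1 * \<Psi>b) - H1 * (\<Phi>2 - \<Gamma>2 * \<Psi>2)"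
    by (intro dvd_add dvd_diff dvd_mult d)
  also have "\<dots> = (A * \<Phi>a + B * \<Phi>b - H1 * \<Phi>2) - \<Gamma>1 * (A * \<Psi>a + B * \<Psi>b) + H1 * \<Gamma>2 * \<Psi>2"
    by (simp add: algebra_simps)
  also have "\<dots> = (H1 * \<Gamma>2 - H2 * \<Gamma>1) * \<Psi>2"
    unfolding assms(1,2)[symmetric] by (simp add: algebra_simps)
  finally have "P dvd (H1 * \<Gamma>2 - H2 * \<Gamma>1) * \<Psi>2 * inverse \<Psi>2"
    by (rule dvd_mult2)
  then show ?thesis
    using nz by (simp add: mult.assoc inverse_mult_eq_1')
qed

section \<open>Rows of coefficients and Jordan blocks\<close>

definition coeff_row :: "nat \<Rightarrow> complex fps \<Rightarrow> complex mat" where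
  "coeff_row m F = mat 1 m (\<lambda>(_, i). fps_nth F i)"

lemma coeff_row_carrier [simp]: "coeff_row m F \<in> carrier_mat 1 m"
  by (simp add: coeff_row_def)

lemma coeff_row_cong:
  assumes "fps_X ^ m dvd F - G"
  shows "coeff_row m F = coeff_row m G"
  using assms by (auto simp: coeff_row_def fps_X_power_dvd_iff intro!: eq_matI)

lemma coeff_row_smult: "coeff_row m (fps_const c * F) = c \<cdot>\<^sub>m coeff_row m F"
  by (auto simp: coeff_row_def intro!: eq_matI)

lemma coeff_row_diff: "coeff_row m (F - G) = coeff_row m F - coeff_row m G"
  by (auto simp: coeff_row_def intro!: eq_matI)

lemma coeff_row_jordan_block:
  "coeff_row m F * jordan_block m z = coeff_row m ((fps_const z + fps_X) * F)"
proof (rule eq_matI)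
  fix i j assume "i < dim_row (coeff_row m ((fps_const z + fps_X) * F))"
    "j < dim_col (coeff_row m ((fps_const z + fps_X) * F))"
  then have ij: "i = 0" "j < m" by (auto simp: coeff_row_def)
  have "(coeff_row m F * jordan_block m z) $$ (i, j) =
      (\<Sum>k = 0..<m. fps_nth F k * (if k = j then z else if Suc k = j then 1 else 0))"
    using ij by (simp add: coeff_row_def scalar_prod_def)
  \<comment> \<open>The superdiagonal contributes nothing to column 0, where truncated subtraction
    would give \<open>j - 1 = 0\<close>; hence the guard \<open>j > 0\<close>.\<close>
  also have "\<dots> = (\<Sum>k = 0..<m. if k = j then fps_nth F k * z else 0) +
      (\<Sum>k = 0..<m. if k = j - 1 \<and> j > 0 then fps_nth F k else 0)"
    unfolding sum.distrib[symmetric] by (rule sum.cong) auto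
  also have "(\<Sum>k = 0..<m. if k = j then fps_nth F k * z else 0) = fps_nth F j * z"
    using ij by simp
  also have "(\<Sum>k = 0..<m. if k = j - 1 \<and> j > 0 then fps_nth F k else 0) =
      (if j = 0 then 0 else fps_nth F (j - 1))"
    using ij by (cases "j = 0") auto
  also have "fps_nth F j * z + (if j = 0 then 0 else fps_nth F (j - 1)) =
      fps_nth ((fps_const z + fps_X) * F) j"
    by (simp add: distrib_right mult.commute[of z])
  finally show "(coeff_row m F * jordan_block m z) $$ (i, j) =
      coeff_row m ((fps_const z + fps_X) * F) $$ (i, j)"
    using ij by (simp add: coeff_row_def)
qed (auto simp: coeff_row_def)

section \<open>Inverses of Jordan blocks\<close>

lemma minv_carrier [simp]: "A \<in> carrier_mat n n \<Longrightarrow> minv A \<in> carrier_mat n n"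
  by (simp add: minv_def adj_mat(1))

lemma minv_mult:
  assumes A: "A \<in> carrier_mat n n" and det: "det A \<noteq> 0"
  shows "A * minv A = 1\<^sub>m n" "minv A * A = 1\<^sub>m n"
  using adj_mat[OF A] A det
  by (auto simp: minv_def mult_smult_distrib[of _ n n _ n] mult_smult_assoc_mat[of _ n n _ n])

lemma minv_eqI:
  assumes A: "A \<in> carrier_mat n n" and B: "B \<in> carrier_mat n n" and AB: "A * B = 1\<^sub>m n"
  shows "det A \<noteq> 0" "minv A = B"
proof -
  have "det A * det B = 1"
    using AB det_mult[OF A B] by simp
  then show det: "det A \<noteq> 0" by auto
  have "minv A = minv A * (A * B)"
    using AB minv_carrier[OF A] by simp
  also have "\<dots> = minv A * A * B"
    by (rule assoc_mult_mat[OF minv_carrier[OF A] A B, symmetric])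
  finally show "minv A = B"
    using minv_mult(2)[OF A det] B by simp
qed

lemma mult_minv_cancel:
  assumes A: "A \<in> carrier_mat n n" and det: "det A \<noteq> 0" and C: "C \<in> carrier_mat k n"
  shows "C * A * minv A = C" "C * minv A * A = C"
  using minv_mult[OF A det] C
  by (simp_all add: assoc_mult_mat[OF C A minv_carrier[OF A]] assoc_mult_mat[OF C minv_carrier[OF A] A])

lemma det_jordan_block: "det (jordan_block m z) = z ^ m" for z :: complex
proof -
  have "det (jordan_block m z) = prod_list (diag_mat (jordan_block m z))"
    by (rule det_upper_triangular) auto
  also have "diag_mat (jordan_block m z) = replicate m z"
    by (auto simp: diag_mat_def intro!: nth_equalityI)
  finally show ?thesis by simp
qed

text \<open>The coordinate series \<open>fps_const z + fps_X\<close> is a unit for nonzero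
  \<open>z\<close>. Dividing \<open>F\<close> by it and multiplying the row by the Jordan block
  gives back the row of \<open>F\<close>, so the inverse block acts as division.\<close>

lemma coeff_row_minv_jordan_block:
  assumes "z \<noteq> 0"
  shows "coeff_row m F * minv (jordan_block m z) = coeff_row m (inverse (fps_const z + fps_X) * F)"
proof -
  have "(fps_const z + fps_X) * (inverse (fps_const z + fps_X) * F) = F"
    using assms by (simp add: mult.assoc[symmetric] inverse_mult_eq_1')
  then have "coeff_row m F =
      coeff_row m (inverse (fps_const z + fps_X) * F) * jordan_block m z"
    by (simp only: coeff_row_jordan_block)
  then show ?thesis
    using mult_minv_cancel(1)[OF jordan_block_carrier _ coeff_row_carrier] assms
    by (simp only: det_jordan_block power_not_zero not_False_eq_True)
qed

lemma IminusAm2_carrier [simp]: "A \<in> carrier_mat n n \<Longrightarrow> IminusAm2 A \<in> carrier_mat n n"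
  unfolding IminusAm2_def by (intro minus_carrier_mat mult_carrier_mat[of _ n n]) auto

text \<open>This is where the scalar gauge factor \<open>1 - z^(-2)\<close> turns into the matrix
  factor of the theorem.\<close>

lemma coeff_row_IminusAm2:
  assumes "z \<noteq> 0"
  shows "coeff_row m F * IminusAm2 (jordan_block m z) =
    coeff_row m (fps_expansion (\<lambda>w. 1 - inverse w * inverse w) z * F)"
proof -
  define P where "P = minv (jordan_block m z)"
  have P: "P \<in> carrier_mat m m" by (simp add: P_def)
  have "coeff_row m F * IminusAm2 (jordan_block m z) = coeff_row m F * (1\<^sub>m m - P * P)"
    by (simp add: IminusAm2_def P_def)
  also have "\<dots> = coeff_row m F - coeff_row m F * P * P"
    by (simp add: mult_minus_distrib_mat[OF coeff_row_carrier one_carrier_mat mult_carrier_mat[OF P P]]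
        assoc_mult_mat[OF coeff_row_carrier P P] right_mult_one_mat[OF coeff_row_carrier])
  also have "\<dots> = coeff_row m (F - inverse (fps_const z + fps_X) * (inverse (fps_const z + fps_X) * F))"
    using assms by (simp add: P_def coeff_row_minv_jordan_block coeff_row_diff)
  also have "inverse analytic_on {z}"
    using assms by (auto intro!: analytic_intros)
  then have "F - inverse (fps_const z + fps_X) * (inverse (fps_const z + fps_X) * F) =
      fps_expansion (\<lambda>w. 1 - inverse w * inverse w) z * F"
    using fps_expansion_inverse_ident[OF assms]
    by (subst fps_expansion_minus, (auto intro!: analytic_intros)[2])
      (subst fps_expansion_mult, auto simp: algebra_simps)
  finally show ?thesis .
qed

text \<open>Multiplication by \<open>A * A\<close> turns the matrix into
  \<open>(A - 1) * (A + 1)\<close>, a product of Jordan blocks with eigenvalues \<open>z - 1\<close>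
  and \<open>z + 1\<close>.\<close>

lemma det_IminusAm2_jordan_block:
  assumes z: "z \<noteq> 0" "z\<^sup>2 \<noteq> 1"
  shows "det (IminusAm2 (jordan_block m z)) \<noteq> 0"
proof
  define A where "A = jordan_block m z"
  define P where "P = minv A"
  have A: "A \<in> carrier_mat m m" and P: "P \<in> carrier_mat m m" by (simp_all add: A_def P_def)
  have PA: "P * A = 1\<^sub>m m"
    using minv_mult(2)[OF A] z by (simp add: P_def A_def det_jordan_block)
  have "P * P * (A * A) = P * (P * A) * A"
    by (simp add: assoc_mult_mat[OF P P mult_carrier_mat[OF A A]] assoc_mult_mat[OF P A A]
        assoc_mult_mat[OF P mult_carrier_mat[OF P A] A])
  also have "\<dots> = 1\<^sub>m m"
    using P PA by simp
  finally have "IminusAm2 A * (A * A) = A * A - 1\<^sub>m m"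
    using A by (simp add: IminusAm2_def P_def[symmetric]
        minus_mult_distrib_mat[OF one_carrier_mat mult_carrier_mat[OF P P] mult_carrier_mat[OF A A]])
  also have "\<dots> = (A - 1\<^sub>m m) * (A + 1\<^sub>m m)"
    using A by (simp add: minus_mult_distrib_mat[of _ m m _ _ m] mult_add_distrib_mat[of _ m m _ m])
      (auto intro!: eq_matI)
  also have "A - 1\<^sub>m m = jordan_block m (z - 1)"
    by (auto simp: A_def intro!: eq_matI)
  also have "A + 1\<^sub>m m = jordan_block m (z + 1)"
    by (auto simp: A_def intro!: eq_matI)
  finally have "det (IminusAm2 A) * det (A * A) = (z - 1) ^ m * (z + 1) ^ m"
    using det_mult[of "IminusAm2 A" m "A * A"] A
    by (simp add: det_mult[of "jordan_block m (z - 1)" m] det_jordan_block)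
  moreover have "(z - 1) * (z + 1) \<noteq> 0"
    using z by (simp add: algebra_simps power2_eq_square)
  moreover assume "det (IminusAm2 (jordan_block m z)) = 0"
  ultimately show False by (simp add: A_def)
qed

section \<open>Block-diagonal matrices and concatenated rows\<close>

lemma diag_block_mat_carrier:
  assumes "\<And>x. x \<in> set xs \<Longrightarrow> f x \<in> carrier_mat (d x) (d x)"
  shows "diag_block_mat (map f xs) \<in> carrier_mat (sum_list (map d xs)) (sum_list (map d xs))"
proof -
  have "map dim_row (map f xs) = map d xs" "map dim_col (map f xs) = map d xs"
    using carrier_matD[OF assms] by simp_all
  then show ?thesis
    by (simp add: dim_diag_block_mat carrier_matI del: map_map)
qed

lemma diag_block_mat_mult:
  fixes f g :: "'i \<Rightarrow> complex mat"
  assumes "\<And>x. x \<in> set xs \<Longrightarrow> f x \<in> carrier_mat (d x) (d x)"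
    and "\<And>x. x \<in> set xs \<Longrightarrow> g x \<in> carrier_mat (d x) (d x)"
  shows "diag_block_mat (map f xs) * diag_block_mat (map g xs) = diag_block_mat (map (\<lambda>x. f x * g x) xs)"
  using assms
proof (induction xs)
  case (Cons x xs)
  define D where "D = sum_list (map d xs)"
  have c: "f x \<in> carrier_mat (d x) (d x)" "g x \<in> carrier_mat (d x) (d x)"
    "diag_block_mat (map f xs) \<in> carrier_mat D D" "diag_block_mat (map g xs) \<in> carrier_mat D D"
    using Cons.prems by (auto simp: D_def intro!: diag_block_mat_carrier)
  have "diag_block_mat (map (\<lambda>x. f x * g x) xs) \<in> carrier_mat D D"
    unfolding D_def by (rule diag_block_mat_carrier) (use Cons.prems in \<open>auto intro!: mult_carrier_mat\<close>)
  moreover have "diag_block_mat (map f xs) * diag_block_mat (map g xs) =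
      diag_block_mat (map (\<lambda>x. f x * g x) xs)"
    using Cons by simp
  ultimately show ?case
    using c by (simp add: Let_def mult_four_block_mat[OF c(1) _ _ c(3) c(2) _ _ c(4)])
qed simp

lemma diag_block_mat_one: "diag_block_mat (map (\<lambda>x. 1\<^sub>m (d x)) xs) = 1\<^sub>m (sum_list (map d xs))"
proof (induction xs)
  case (Cons x xs)
  then show ?case by (auto simp: Let_def intro!: eq_matI)
qed auto

lemma diag_block_mat_minus:
  fixes f g :: "'i \<Rightarrow> complex mat"
  assumes "\<And>x. x \<in> set xs \<Longrightarrow> f x \<in> carrier_mat (d x) (d x)"
    and "\<And>x. x \<in> set xs \<Longrightarrow> g x \<in> carrier_mat (d x) (d x)"
  shows "diag_block_mat (map f xs) - diag_block_mat (map g xs) = diag_block_mat (map (\<lambda>x. f x - g x) xs)"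
  using assms
proof (induction xs)
  case (Cons x xs)
  define D where "D = sum_list (map d xs)"
  have c: "f x \<in> carrier_mat (d x) (d x)" "g x \<in> carrier_mat (d x) (d x)"
    "diag_block_mat (map f xs) \<in> carrier_mat D D" "diag_block_mat (map g xs) \<in> carrier_mat D D"
    using Cons.prems by (auto simp: D_def intro!: diag_block_mat_carrier)
  have e: "diag_block_mat (map (\<lambda>x. f x - g x) xs) = diag_block_mat (map f xs) - diag_block_mat (map g xs)"
    using Cons by simp
  show ?case
    using c by (auto simp: Let_def e intro!: eq_matI)
qed simp

context
  fixes f :: "'i \<Rightarrow> complex mat" and d :: "'i \<Rightarrow> nat" and xs :: "'i list"
  assumes car: "\<And>x. x \<in> set xs \<Longrightarrow> f x \<in> carrier_mat (d x) (d x)"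
begin

lemma minv_diag_block_mat:
  assumes det: "\<And>x. x \<in> set xs \<Longrightarrow> det (f x) \<noteq> 0"
  shows "det (diag_block_mat (map f xs)) \<noteq> 0"
    "minv (diag_block_mat (map f xs)) = diag_block_mat (map (\<lambda>x. minv (f x)) xs)"
proof -
  have "diag_block_mat (map f xs) * diag_block_mat (map (\<lambda>x. minv (f x)) xs) =
      diag_block_mat (map (\<lambda>x. f x * minv (f x)) xs)"
    by (rule diag_block_mat_mult[where d = d]) (use car in auto)
  also have "map (\<lambda>x. f x * minv (f x)) xs = map (\<lambda>x. 1\<^sub>m (d x)) xs"
    using minv_mult(1)[OF car det] by auto
  finally have *: "diag_block_mat (map f xs) * diag_block_mat (map (\<lambda>x. minv (f x)) xs) =
      1\<^sub>m (sum_list (map d xs))"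
    by (simp add: diag_block_mat_one)
  have c: "diag_block_mat (map f xs) \<in> carrier_mat (sum_list (map d xs)) (sum_list (map d xs))"
    "diag_block_mat (map (\<lambda>x. minv (f x)) xs) \<in> carrier_mat (sum_list (map d xs)) (sum_list (map d xs))"
    by (rule diag_block_mat_carrier; use car in simp)+
  show "det (diag_block_mat (map f xs)) \<noteq> 0"
    "minv (diag_block_mat (map f xs)) = diag_block_mat (map (\<lambda>x. minv (f x)) xs)"
    using minv_eqI[OF c *] .
qed

lemma IminusAm2_diag_block_mat:
  assumes det: "\<And>x. x \<in> set xs \<Longrightarrow> det (f x) \<noteq> 0"
  shows "IminusAm2 (diag_block_mat (map f xs)) = diag_block_mat (map (\<lambda>x. IminusAm2 (f x)) xs)"
proof -
  let ?n = "sum_list (map d xs)"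
  have "dim_row (diag_block_mat (map f xs)) = ?n"
    using diag_block_mat_carrier[of xs f d] car by auto
  then have "IminusAm2 (diag_block_mat (map f xs)) = diag_block_mat (map (\<lambda>x. 1\<^sub>m (d x)) xs) -
      diag_block_mat (map (\<lambda>x. minv (f x)) xs) * diag_block_mat (map (\<lambda>x. minv (f x)) xs)"
    by (simp add: IminusAm2_def minv_diag_block_mat[OF det] diag_block_mat_one)
  also have "\<dots> = diag_block_mat (map (\<lambda>x. 1\<^sub>m (d x) - minv (f x) * minv (f x)) xs)"
    using car by (simp add: diag_block_mat_mult[where d = d] diag_block_mat_minus[where d = d]
        mult_carrier_mat[OF minv_carrier minv_carrier])
  also have "map (\<lambda>x. 1\<^sub>m (d x) - minv (f x) * minv (f x)) xs = map (\<lambda>x. IminusAm2 (f x)) xs"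
    using carrier_matD(1)[OF car] by (simp add: IminusAm2_def)
  finally show ?thesis .
qed

end

lemma hconcat_carrier:
  assumes "\<And>x. x \<in> set xs \<Longrightarrow> c x \<in> carrier_mat 1 (d x)"
  shows "hconcat (map c xs) \<in> carrier_mat 1 (sum_list (map d xs))"
  using assms
proof (induction xs)
  case (Cons x xs)
  then have "hconcat (map c xs) \<in> carrier_mat 1 (sum_list (map d xs))" by simp
  then have "dim_row (hconcat (map c xs)) = 1" "dim_col (hconcat (map c xs)) = sum_list (map d xs)"
    by (rule carrier_matD)+
  moreover have "c x \<in> carrier_mat 1 (d x)"
    using Cons.prems by simp
  then have "dim_row (c x) = 1" "dim_col (c x) = d x"
    by (rule carrier_matD)+
  ultimately show ?case
    by (intro carrier_matI) (simp_all add: Let_def)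
qed simp

lemma hconcat_smult:
  assumes "\<And>x. x \<in> set xs \<Longrightarrow> c x \<in> carrier_mat 1 (d x)"
  shows "hconcat (map (\<lambda>x. k \<cdot>\<^sub>m c x) xs) = k \<cdot>\<^sub>m hconcat (map c xs)"
  using assms
proof (induction xs)
  case (Cons x xs)
  have c: "c x \<in> carrier_mat 1 (d x)" "hconcat (map c xs) \<in> carrier_mat 1 (sum_list (map d xs))"
    using Cons.prems hconcat_carrier[of xs c d] by (simp_all del: One_nat_def)
  have "hconcat (map (\<lambda>x. k \<cdot>\<^sub>m c x) xs) = k \<cdot>\<^sub>m hconcat (map c xs)"
    using Cons by simp
  then show ?case
    using c by (auto simp: Let_def intro!: eq_matI)
qed auto

lemma hconcat_mult_diag_block_mat:
  assumes "\<And>x. x \<in> set xs \<Longrightarrow> c x \<in> carrier_mat 1 (d x)"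
    and "\<And>x. x \<in> set xs \<Longrightarrow> f x \<in> carrier_mat (d x) (d x)"
  shows "hconcat (map c xs) * diag_block_mat (map f xs) = hconcat (map (\<lambda>x. c x * f x) xs)"
  using assms
proof (induction xs)
  case (Cons x xs)
  define D where "D = sum_list (map d xs)"
  have c: "c x \<in> carrier_mat 1 (d x)" "f x \<in> carrier_mat (d x) (d x)"
    "hconcat (map c xs) \<in> carrier_mat 1 D" "diag_block_mat (map f xs) \<in> carrier_mat D D"
    using Cons.prems hconcat_carrier[of xs c d] diag_block_mat_carrier[of xs f d]
    by (simp_all add: D_def del: One_nat_def)
  have "hconcat (map (\<lambda>x. c x * f x) xs) \<in> carrier_mat 1 D"
    unfolding D_def
  proof (rule hconcat_carrier)
    fix y assume "y \<in> set xs"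
    then show "c y * f y \<in> carrier_mat 1 (d y)"
      using Cons.prems by (intro mult_carrier_mat[of _ 1 "d y"]) (simp_all del: One_nat_def)
  qed
  moreover have "hconcat (map c xs) * diag_block_mat (map f xs) = hconcat (map (\<lambda>x. c x * f x) xs)"
    using Cons by simp
  ultimately show ?case
    \<comment> \<open>A concatenated row is a block matrix whose lower blocks have no rows, hence
      the second row count 0.\<close>
    using c by (simp add: Let_def mult_four_block_mat[OF c(1) c(3) _ _ c(2) _ _ c(4),
        where ?nr2.0 = 0])
qed auto

section \<open>Norming constants under gauge transformations\<close>

text \<open>With \<open>t k\<close> the coefficient of \<open>(z - z_j)^(-k)\<close>, the first
  series is \<open>(z - z_j)^m T\<close> to order \<open>m\<close>, and the second collects the
  dependency constants. From exponent \<open>m\<close> on, truncated subtraction yields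
  \<open>t 0\<close>, beyond the coefficients that \<open>coeff_row m\<close> reads.\<close>

definition norm_series :: "complex \<Rightarrow> nat \<Rightarrow> (nat \<Rightarrow> complex) \<Rightarrow> (nat \<Rightarrow> complex) \<Rightarrow> complex fps" where
  "norm_series c m t g = fps_const c * (Abs_fps (\<lambda>p. t (m - p)) * Abs_fps (\<lambda>l. g l / fact l))"

text \<open>The index stays unsimplified to match the norming constant with
  \<open>k = m - 1 - i\<close>, which stands in column \<open>i\<close> of the reversed row.\<close>

lemma norm_series_nth:
  assumes "i < m"
  shows "fps_nth (norm_series c m t g) i =
    c * (\<Sum>l\<le>m - 1 - (m - 1 - i). t (m - 1 - i + 1 + l) * g l / fact l)"
proof -
  have "fps_nth (norm_series c m t g) i = c * (\<Sum>l=0..i. g l / fact l * t (m - (i - l)))"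
    unfolding norm_series_def mult.commute[of "Abs_fps (\<lambda>p. t (m - p))"] fps_mult_left_const_nth
    by (simp only: fps_mult_nth fps_nth_Abs_fps)
  also have "(\<Sum>l=0..i. g l / fact l * t (m - (i - l))) =
      (\<Sum>l\<le>m - 1 - (m - 1 - i). t (m - 1 - i + 1 + l) * g l / fact l)"
  proof (rule sum.cong)
    show "{0..i} = {..m - 1 - (m - 1 - i)}" using assms by auto
    show "g l / fact l * t (m - (i - l)) = t (m - 1 - i + 1 + l) * g l / fact l"
      if "l \<in> {..m - 1 - (m - 1 - i)}" for l
    proof -
      have "m - (i - l) = m - 1 - i + 1 + l" using that assms by auto
      then show ?thesis by simp
    qed
  qed
  finally show ?thesis .
qed

lemma Cblk_eq_coeff_row:
  "Cblk d zs ms j = coeff_row (ms j) (norm_series (- 2) (ms j) (tres d zs j) (gam d j))"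
  "Cblkb d zs ms j = coeff_row (ms j) (norm_series 2 (ms j) (tresb d zs j) (gamb d j))"
  unfolding Cblk_def Cblkb_def coeff_row_def norm_c_def norm_cb_def
  by (rule cong_mat; simp only: norm_series_nth prod.case)+

text \<open>\<open>A\<close> and \<open>B\<close> form one row of the gauge matrix, acting on the
  components \<open>a\<close> and \<open>b\<close> of the source; \<open>h1\<close> and
  \<open>h2\<close> are the factors acquired by \<open>phi\<close> and \<open>psi\<close>. The
  dependency series then satisfy \<open>h1 G2 = h2 G1\<close> to order \<open>m\<close>, and
  multiplication by the polar part of the transmission coefficient gives the rows.\<close>

lemma norm_series_transfer:
  assumes S: "open S" "z \<in> S"
    and hol: "\<phi>a holomorphic_on S" "\<phi>b holomorphic_on S" "\<psi>a holomorphic_on S" "\<psi>b holomorphic_on S"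
      "\<phi>2 holomorphic_on S" "\<psi>2 holomorphic_on S" "A holomorphic_on S" "B holomorphic_on S"
      "h1 holomorphic_on S" "h2 holomorphic_on S"
    and eq: "\<And>w. w \<in> S \<Longrightarrow> h1 w * \<phi>2 w = A w * \<phi>a w + B w * \<phi>b w"
      "\<And>w. w \<in> S \<Longrightarrow> h2 w * \<psi>2 w = A w * \<psi>a w + B w * \<psi>b w"
    and dep:
      "\<forall>k<m. (deriv ^^ k) \<phi>a z = (\<Sum>l\<le>k. of_nat (k choose l) * g1 (k - l) * (deriv ^^ l) \<psi>a z)"
      "\<forall>k<m. (deriv ^^ k) \<phi>b z = (\<Sum>l\<le>k. of_nat (k choose l) * g1 (k - l) * (deriv ^^ l) \<psi>b z)"
      "\<forall>k<m. (deriv ^^ k) \<phi>2 z = (\<Sum>l\<le>k. of_nat (k choose l) * g2 (k - l) * (deriv ^^ l) \<psi>2 z)"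
    and nz: "\<psi>2 z \<noteq> 0"
    and t: "\<And>k. t2 k = t1 k / c"
  shows "coeff_row m (fps_expansion h1 z * norm_series \<kappa> m t2 g2) =
    coeff_row m (fps_const (1 / c) * (fps_expansion h2 z * norm_series \<kappa> m t1 g1))"
proof (rule coeff_row_cong)
  have an: "f analytic_on {z}" if "f holomorphic_on S" for f
    using that S analytic_at by blast
  have near: "\<forall>\<^sub>F w in nhds z. w \<in> S"
    using S by (rule eventually_nhds_in_open)
  define G1 G2 where "G1 = Abs_fps (\<lambda>l. g1 l / fact l)" and "G2 = Abs_fps (\<lambda>l. g2 l / fact l)"
  define T where "T = Abs_fps (\<lambda>p. t1 (m - p))"
  define H1 H2 where "H1 = fps_expansion h1 z" and "H2 = fps_expansion h2 z"
  have "fps_expansion (\<lambda>w. h1 w * \<phi>2 w) z = fps_expansion (\<lambda>w. A w * \<phi>a w + B w * \<phi>b w) z"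
    "fps_expansion (\<lambda>w. h2 w * \<psi>2 w) z = fps_expansion (\<lambda>w. A w * \<psi>a w + B w * \<psi>b w) z"
    by (rule fps_expansion_cong; rule eventually_mono[OF near]; simp add: eq)+
  then have "H1 * fps_expansion \<phi>2 z =
      fps_expansion A z * fps_expansion \<phi>a z + fps_expansion B z * fps_expansion \<phi>b z"
    "H2 * fps_expansion \<psi>2 z =
      fps_expansion A z * fps_expansion \<psi>a z + fps_expansion B z * fps_expansion \<psi>b z"
    unfolding H1_def H2_def
    by (simp_all add: fps_expansion_mult fps_expansion_add an hol analytic_on_mult)
  then have d: "fps_X ^ m dvd H1 * G2 - H2 * G1"
    using dep[THEN gamma_dvd, folded G1_def G2_def]
    by (rule gamma_unique) (use nz in \<open>simp add: fps_expansion_def\<close>)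
  have t2: "Abs_fps (\<lambda>p. t2 (m - p)) = fps_const (1 / c) * T"
    unfolding T_def t by (rule fps_ext) simp
  have "H1 * norm_series \<kappa> m t2 g2 - fps_const (1 / c) * (H2 * norm_series \<kappa> m t1 g1) =
      fps_const \<kappa> * fps_const (1 / c) * T * (H1 * G2 - H2 * G1)"
    unfolding norm_series_def t2 G1_def[symmetric] G2_def[symmetric] T_def[symmetric]
    by (simp only: algebra_simps)
  then show "fps_X ^ m dvd fps_expansion h1 z * norm_series \<kappa> m t2 g2 -
      fps_const (1 / c) * (fps_expansion h2 z * norm_series \<kappa> m t1 g1)"
    using d by (simp only: H1_def H2_def dvd_mult)
qed

text \<open>Pulling a constant out of a residue requires holomorphy on a punctured neighbourhood;
  deleting the finitely many other zeros of \<open>f\<close> provides one.\<close>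

lemma residue_scaled_denominator:
  assumes S: "open S" "z \<in> S" and f: "f holomorphic_on S" and fin: "finite {w \<in> S. f w = 0}"
    and g: "\<And>w. w \<in> S \<Longrightarrow> g w = c * f w"
  shows "residue (\<lambda>w. (w - z) ^ k / g w) z = residue (\<lambda>w. (w - z) ^ k / f w) z / c"
proof -
  define U where "U = S - ({w \<in> S. f w = 0} - {z})"
  have U: "open U" "z \<in> U"
    using S fin unfolding U_def by (auto intro!: open_Diff finite_imp_closed)
  have "residue (\<lambda>w. (w - z) ^ k / g w) z = residue (\<lambda>w. 1 / c * ((w - z) ^ k / f w)) z"
  proof (rule residue_cong)
    have "\<forall>\<^sub>F w in at z. w \<in> S"
      using eventually_at_in_open'[OF S] .
    then show "\<forall>\<^sub>F w in at z. (w - z) ^ k / g w = 1 / c * ((w - z) ^ k / f w)"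
      by eventually_elim (simp add: g)
  qed simp
  also have "\<dots> = 1 / c * residue (\<lambda>w. (w - z) ^ k / f w) z"
  proof (rule residue_lmul[OF U])
    have "f holomorphic_on U - {z}"
      by (rule holomorphic_on_subset[OF f]) (auto simp: U_def)
    then show "(\<lambda>w. (w - z) ^ k / f w) holomorphic_on U - {z}"
      by (intro holomorphic_intros) (auto simp: U_def)
  qed
  finally show ?thesis by simp
qed

section \<open>Gauge maps and their effect on scattering data\<close>

type_synonym matrix2 = "(complex \<times> complex) \<times> (complex \<times> complex)"

definition mult_vec2 :: "matrix2 \<Rightarrow> complex \<times> complex \<Rightarrow> complex \<times> complex" (infixr "*\<^sub>2" 75) where
  "M *\<^sub>2 w = (fst (fst M) * fst w + snd (fst M) * snd w, fst (snd M) * fst w + snd (snd M) * snd w)"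

definition cscale :: "complex \<Rightarrow> complex \<times> complex \<Rightarrow> complex \<times> complex" where
  "cscale c w = (c * fst w, c * snd w)"

lemma is_sol_sysU_cscale:
  assumes "is_sol (sysU a b) z w"
  shows "is_sol (sysU a b) z (\<lambda>n. cscale c (w n))"
  unfolding is_sol_def
proof
  fix n
  have "cscale c (w n) = cscale c (sysU a b z n (w (n + 1)))"
    by (rule arg_cong, rule spec[OF assms[unfolded is_sol_def]])
  then show "cscale c (w n) = sysU a b z n (cscale c (w (n + 1)))"
    by (simp add: cscale_def sysU_def algebra_simps)
qed

lemma jost_limit_cscale:
  assumes "jost_limit z w v F"
  shows "jost_limit z (\<lambda>n. cscale c (w n)) (cscale c v) F"
  using assms unfolding jost_limit_def cscale_def fst_conv snd_conv mult.assoc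
  by (auto intro: tendsto_mult_left)

lemma jost_limit_zero_iff:
  assumes "cmod z = 1"
  shows "((\<lambda>n. f n * z powi n) \<longlongrightarrow> 0) F \<longleftrightarrow> (f \<longlongrightarrow> 0) F"
    "((\<lambda>n. f n * z powi (- n)) \<longlongrightarrow> 0) F \<longleftrightarrow> (f \<longlongrightarrow> 0) F"
  by (subst (1 2) tendsto_norm_zero_iff[symmetric];
      simp only: norm_mult norm_powi_eq_1[OF assms] mult_1_right)+

lemma jost_solutionsD:
  assumes "jost_solutions S d" and z: "cmod z = 1"
  shows "jost_limit z (jpsi d z) (0, 1) at_top" "jost_limit z (jpsib d z) (1, 0) at_top"
    "jost_limit z (jphi d z) (1, 0) at_bot" "jost_limit z (jphib d z) (0, 1) at_bot"
  using assms unfolding jost_solutions_def jost_limit_def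
  by (simp_all only: fst_conv snd_conv jost_limit_zero_iff[OF z])

text \<open>Exchanging the components while inverting \<open>z\<close> exchanges the two potentials.
  This symmetry carries the nonvanishing result inside the disc to the exterior.\<close>

lemma sysU_swap: "prod.swap (sysU a b (inverse z) n w) = sysU b a z n (prod.swap w)"
  by (simp add: sysU_def add.commute)

context summable_potentials
begin

lemma outer_jost_nonzero:
  assumes ext: "\<And>n. outer_ext (\<lambda>z. fst (w z n))"
    and sol: "\<And>z. cmod z = 1 \<Longrightarrow> is_sol (sysU a b) z (w z)"
    and lim: "\<And>z. cmod z = 1 \<Longrightarrow> jost_limit z (w z) (1, 0) at_top"
    and z0: "1 < cmod z0"
  obtains n where "fst (w z0 n) \<noteq> 0"
proof -
  define w' where "w' = (\<lambda>z n. prod.swap (w (inverse z) n))"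
  interpret swapped: summable_potentials b a
    using summ_a summ_b det_nz by unfold_locales (simp_all add: mult.commute)
  have z0': "0 < cmod (inverse z0)" "cmod (inverse z0) < 1"
    using z0 by (auto simp: norm_inverse inverse_less_1_iff)
  obtain n where "snd (w' (inverse z0) n) \<noteq> 0"
  proof (rule swapped.inner_jost_nonzero[where w = w', OF _ _ _ z0'])
    show "inner_ext (\<lambda>z. snd (w' z n))" for n
      using inner_ext_compose_inverse[OF ext] by (simp add: w'_def)
    fix z :: complex assume z: "cmod z = 1"
    then have iz: "cmod (inverse z) = 1" by (simp add: norm_inverse)
    show "is_sol (sysU b a) z (w' z)"
      unfolding is_sol_def
    proof
      fix n
      have "w (inverse z) n = sysU a b (inverse z) n (w (inverse z) (n + 1))"
        by (rule spec[OF sol[OF iz, unfolded is_sol_def]])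
      then show "w' z n = sysU b a z n (w' z (n + 1))"
        unfolding w'_def sysU_swap[symmetric] by simp
    qed
    show "jost_limit z (w' z) (0, 1) at_top"
      using lim[OF iz] by (simp add: jost_limit_def w'_def power_int_inverse power_int_minus)
  qed
  then show ?thesis using that by (simp add: w'_def)
qed

end

text \<open>The factor \<open>h\<close> carries the zeros of the gauge determinant at \<open>z = 1\<close> and \<open>z = - 1\<close>; \<open>k\<close> covers limits
  known to exist only after multiplication by a function vanishing at these points.\<close>

locale gauge = summable_potentials a b for a b :: "int \<Rightarrow> complex" +
  fixes S :: system and M :: "int \<Rightarrow> complex \<Rightarrow> matrix2" and h k :: "complex \<Rightarrow> complex"
    and e d :: complex
  assumes M_ext: "\<And>n. inner_ext (\<lambda>z. fst (fst (M n z)))" "\<And>n. inner_ext (\<lambda>z. snd (fst (M n z)))"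
      "\<And>n. inner_ext (\<lambda>z. fst (snd (M n z)))" "\<And>n. inner_ext (\<lambda>z. snd (snd (M n z)))"
      "\<And>n. outer_ext (\<lambda>z. fst (fst (M n z)))" "\<And>n. outer_ext (\<lambda>z. snd (fst (M n z)))"
      "\<And>n. outer_ext (\<lambda>z. fst (snd (M n z)))" "\<And>n. outer_ext (\<lambda>z. snd (snd (M n z)))"
    and hk_ext: "inner_ext h" "outer_ext h" "inner_ext k" "outer_ext k"
    and hk_nz: "\<And>z. z \<noteq> 0 \<Longrightarrow> cmod z \<noteq> 1 \<Longrightarrow> h z \<noteq> 0" "\<And>z. z \<noteq> 0 \<Longrightarrow> cmod z \<noteq> 1 \<Longrightarrow> k z \<noteq> 0"
    and M_sol: "\<And>z w. z \<noteq> 0 \<Longrightarrow> is_sol S z w \<Longrightarrow> is_sol (sysU a b) z (\<lambda>n. M n z *\<^sub>2 w n)"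
    and M_bot: "\<And>z w v. cmod z = 1 \<Longrightarrow> jost_limit z w v at_bot \<Longrightarrow>
      jost_limit z (\<lambda>n. M n z *\<^sub>2 w n) (fst v, h z * snd v) at_bot"
    and M_top: "\<And>z w v. cmod z = 1 \<Longrightarrow> jost_limit z w v at_top \<Longrightarrow>
      jost_limit z (\<lambda>n. M n z *\<^sub>2 w n) (e * fst v, d * h z * snd v) at_top"
    and M_top_fst: "\<And>z w l. cmod z = 1 \<Longrightarrow> is_sol S z w \<Longrightarrow>
      ((\<lambda>n. fst (w n) * z powi n) \<longlongrightarrow> l) at_top \<Longrightarrow>
      ((\<lambda>n. k z * (fst (M n z *\<^sub>2 w n) * z powi n)) \<longlongrightarrow> k z * (e * l)) at_top"
    and M_top_snd: "\<And>z w l. cmod z = 1 \<Longrightarrow> is_sol S z w \<Longrightarrow>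
      ((\<lambda>n. snd (w n) * z powi (- n)) \<longlongrightarrow> l) at_top \<Longrightarrow>
      ((\<lambda>n. k z * (snd (M n z *\<^sub>2 w n) * z powi (- n))) \<longlongrightarrow> k z * (d * h z * l)) at_top"
begin

context
  fixes d1 d2 :: sdata
  assumes jost: "jost_solutions S d1" "jost_solutions (sysU a b) d2"
    and trans: "transmission d1" "transmission d2"
begin

lemma sols:
  assumes "z \<noteq> 0"
  shows "cmod z \<le> 1 \<Longrightarrow> is_sol (sysU a b) z (\<lambda>n. M n z *\<^sub>2 jphi d1 z n)"
    "cmod z \<le> 1 \<Longrightarrow> is_sol (sysU a b) z (\<lambda>n. M n z *\<^sub>2 jpsi d1 z n)"
    "1 \<le> cmod z \<Longrightarrow> is_sol (sysU a b) z (\<lambda>n. M n z *\<^sub>2 jphib d1 z n)"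
    "1 \<le> cmod z \<Longrightarrow> is_sol (sysU a b) z (\<lambda>n. M n z *\<^sub>2 jpsib d1 z n)"
    "cmod z \<le> 1 \<Longrightarrow> is_sol (sysU a b) z (jphi d2 z)"
    "cmod z \<le> 1 \<Longrightarrow> is_sol (sysU a b) z (jpsi d2 z)"
    "1 \<le> cmod z \<Longrightarrow> is_sol (sysU a b) z (jphib d2 z)"
    "1 \<le> cmod z \<Longrightarrow> is_sol (sysU a b) z (jpsib d2 z)"
  using assms jost by (auto intro!: M_sol simp: jost_solutions_def)

text \<open>Each side solves the same (U) system, and the leading behaviour agrees at the end where
  the Jost solution is normalized: minus infinity for \<open>jphi\<close>, \<open>jphib\<close> and
  plus infinity for \<open>jpsi\<close>, \<open>jpsib\<close>. The factors are the limits of the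
  gauge on \<open>(1, 0)\<close> and \<open>(0, 1)\<close>.\<close>

lemma circle_eqs:
  assumes z: "cmod z = 1"
  shows "M n z *\<^sub>2 jphi d1 z n = jphi d2 z n"
    "M n z *\<^sub>2 jpsi d1 z n = cscale (d * h z) (jpsi d2 z n)"
    "M n z *\<^sub>2 jphib d1 z n = cscale (h z) (jphib d2 z n)"
    "M n z *\<^sub>2 jpsib d1 z n = cscale e (jpsib d2 z n)"
proof -
  have nz: "z \<noteq> 0" and le: "cmod z \<le> 1" and ge: "1 \<le> cmod z" using z by auto
  note l1 = jost_solutionsD[OF jost(1) z] and l2 = jost_solutionsD[OF jost(2) z]
  show "M n z *\<^sub>2 jphi d1 z n = jphi d2 z n"
    by (rule sol_eq_if_jost_limit[OF z sols(1)[OF nz le] sols(5)[OF nz le] M_bot[OF z l1(3)]])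
      (use l2(3) in simp_all)
  show "M n z *\<^sub>2 jpsi d1 z n = cscale (d * h z) (jpsi d2 z n)"
    by (rule sol_eq_if_jost_limit[OF z sols(2)[OF nz le] is_sol_sysU_cscale[OF sols(6)[OF nz le]]
        M_top[OF z l1(1)]])
      (use jost_limit_cscale[OF l2(1), of "d * h z"] in \<open>simp_all add: cscale_def\<close>)
  show "M n z *\<^sub>2 jphib d1 z n = cscale (h z) (jphib d2 z n)"
    by (rule sol_eq_if_jost_limit[OF z sols(3)[OF nz ge] is_sol_sysU_cscale[OF sols(7)[OF nz ge]]
        M_bot[OF z l1(4)]])
      (use jost_limit_cscale[OF l2(4), of "h z"] in \<open>simp_all add: cscale_def\<close>)
  show "M n z *\<^sub>2 jpsib d1 z n = cscale e (jpsib d2 z n)"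
    by (rule sol_eq_if_jost_limit[OF z sols(4)[OF nz ge] is_sol_sysU_cscale[OF sols(8)[OF nz ge]]
        M_top[OF z l1(2)]])
      (use jost_limit_cscale[OF l2(2), of e] in \<open>simp_all add: cscale_def\<close>)
qed

lemma jost_ext:
  "inner_ext (\<lambda>z. fst (jpsi d1 z n))" "inner_ext (\<lambda>z. snd (jpsi d1 z n))"
  "inner_ext (\<lambda>z. fst (jphi d1 z n))" "inner_ext (\<lambda>z. snd (jphi d1 z n))"
  "outer_ext (\<lambda>z. fst (jpsib d1 z n))" "outer_ext (\<lambda>z. snd (jpsib d1 z n))"
  "outer_ext (\<lambda>z. fst (jphib d1 z n))" "outer_ext (\<lambda>z. snd (jphib d1 z n))"
  "inner_ext (\<lambda>z. fst (jpsi d2 z n))" "inner_ext (\<lambda>z. snd (jpsi d2 z n))"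
  "inner_ext (\<lambda>z. fst (jphi d2 z n))" "inner_ext (\<lambda>z. snd (jphi d2 z n))"
  "outer_ext (\<lambda>z. fst (jpsib d2 z n))" "outer_ext (\<lambda>z. snd (jpsib d2 z n))"
  "outer_ext (\<lambda>z. fst (jphib d2 z n))" "outer_ext (\<lambda>z. snd (jphib d2 z n))"
  using jost unfolding jost_solutions_def by simp_all

text \<open>The second component is continued because it is the one in which \<open>jpsi\<close> is
  known to be nonzero for some \<open>n\<close>; outside the disc this is the first
  component.\<close>

lemma inner_eqs:
  assumes z: "0 < cmod z" "cmod z \<le> 1"
  shows "snd (jphi d2 z n) =
      fst (snd (M n z)) * fst (jphi d1 z n) + snd (snd (M n z)) * snd (jphi d1 z n)"
    "d * h z * snd (jpsi d2 z n) =
      fst (snd (M n z)) * fst (jpsi d1 z n) + snd (snd (M n z)) * snd (jpsi d1 z n)"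
proof -
  show "snd (jphi d2 z n) =
      fst (snd (M n z)) * fst (jphi d1 z n) + snd (snd (M n z)) * snd (jphi d1 z n)"
    by (rule inner_ext_eqI[where f = "\<lambda>z. snd (jphi d2 z n)" and
          g = "\<lambda>z. fst (snd (M n z)) * fst (jphi d1 z n) + snd (snd (M n z)) * snd (jphi d1 z n)"])
      (use circle_eqs(1) z in \<open>auto intro!: inner_ext_add inner_ext_mult M_ext jost_ext
        simp: mult_vec2_def prod_eq_iff\<close>)
  show "d * h z * snd (jpsi d2 z n) =
      fst (snd (M n z)) * fst (jpsi d1 z n) + snd (snd (M n z)) * snd (jpsi d1 z n)"
    by (rule inner_ext_eqI[where f = "\<lambda>z. d * h z * snd (jpsi d2 z n)" and
          g = "\<lambda>z. fst (snd (M n z)) * fst (jpsi d1 z n) + snd (snd (M n z)) * snd (jpsi d1 z n)"])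
      (use circle_eqs(2) z in \<open>auto intro!: inner_ext_add inner_ext_mult M_ext jost_ext hk_ext
        inner_ext_const simp: mult_vec2_def prod_eq_iff cscale_def\<close>)
qed

lemma outer_eqs:
  assumes z: "1 \<le> cmod z"
  shows "h z * fst (jphib d2 z n) =
      fst (fst (M n z)) * fst (jphib d1 z n) + snd (fst (M n z)) * snd (jphib d1 z n)"
    "e * fst (jpsib d2 z n) =
      fst (fst (M n z)) * fst (jpsib d1 z n) + snd (fst (M n z)) * snd (jpsib d1 z n)"
proof -
  show "h z * fst (jphib d2 z n) =
      fst (fst (M n z)) * fst (jphib d1 z n) + snd (fst (M n z)) * snd (jphib d1 z n)"
    by (rule outer_ext_eqI[where f = "\<lambda>z. h z * fst (jphib d2 z n)" and
          g = "\<lambda>z. fst (fst (M n z)) * fst (jphib d1 z n) + snd (fst (M n z)) * snd (jphib d1 z n)"])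
      (use circle_eqs(3) z in \<open>auto intro!: outer_ext_add outer_ext_mult M_ext jost_ext hk_ext
        simp: mult_vec2_def prod_eq_iff cscale_def\<close>)
  show "e * fst (jpsib d2 z n) =
      fst (fst (M n z)) * fst (jpsib d1 z n) + snd (fst (M n z)) * snd (jpsib d1 z n)"
    by (rule outer_ext_eqI[where f = "\<lambda>z. e * fst (jpsib d2 z n)" and
          g = "\<lambda>z. fst (fst (M n z)) * fst (jpsib d1 z n) + snd (fst (M n z)) * snd (jpsib d1 z n)"])
      (use circle_eqs(4) z in \<open>auto intro!: outer_ext_add outer_ext_mult M_ext jost_ext
        outer_ext_const simp: mult_vec2_def prod_eq_iff cscale_def\<close>)
qed

text \<open>The reciprocal transmission coefficient prescribes the first component of
  \<open>jphi\<close> at plus infinity and says nothing about the second, so the limit comes from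
  \<open>M_top_fst\<close>. After continuation \<open>k\<close> is cancelled, having no zeros inside
  the punctured disc.\<close>

lemma tinv_eq:
  assumes z: "0 < cmod z" "cmod z < 1"
  shows "tinv d2 z = e * tinv d1 z"
proof -
  have "k w * tinv d2 w = k w * (e * tinv d1 w)" if w: "cmod w = 1" for w
  proof -
    have "((\<lambda>n. k w * (fst (M n w *\<^sub>2 jphi d1 w n) * w powi n)) \<longlongrightarrow> k w * (e * tinv d1 w)) at_top"
    proof (rule M_top_fst[OF w])
      have "0 < cmod w \<and> cmod w \<le> 1" using w by simp
      then show "is_sol S w (jphi d1 w)"
        using jost(1) unfolding jost_solutions_def by blast
      show "((\<lambda>n. fst (jphi d1 w n) * w powi n) \<longlongrightarrow> tinv d1 w) at_top"
        using trans(1) w unfolding transmission_def by blast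
    qed
    moreover have "((\<lambda>n. fst (jphi d2 w n) * w powi n) \<longlongrightarrow> tinv d2 w) at_top"
      using trans(2) w unfolding transmission_def by blast
    then have "((\<lambda>n. k w * (fst (jphi d2 w n) * w powi n)) \<longlongrightarrow> k w * tinv d2 w) at_top"
      by (rule tendsto_mult_left)
    ultimately show ?thesis
      unfolding circle_eqs(1)[OF w] by - (rule tendsto_unique[OF trivial_limit_at_top_linorder])
  qed
  moreover have "inner_ext (tinv d1)" "inner_ext (tinv d2)"
    using trans unfolding transmission_def by blast+
  then have "inner_ext (\<lambda>z. k z * tinv d2 z)" "inner_ext (\<lambda>z. k z * (e * tinv d1 z))"
    using inner_ext_mult[OF hk_ext(3)] inner_ext_mult[OF hk_ext(3) inner_ext_mult[OF inner_ext_const]]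
    by blast+
  ultimately have "k z * tinv d2 z = k z * (e * tinv d1 z)"
    using inner_ext_eqI[of "\<lambda>z. k z * tinv d2 z" "\<lambda>z. k z * (e * tinv d1 z)" z] z by simp
  moreover have "k z \<noteq> 0" using hk_nz(2)[of z] z by auto
  ultimately show ?thesis by simp
qed

text \<open>Here \<open>jphib\<close> itself is rescaled by \<open>h\<close>, so \<open>h\<close>
  occurs on both sides and is cancelled off the circle together with \<open>k\<close>.\<close>

lemma tinvb_eq:
  assumes z: "1 < cmod z"
  shows "tinvb d2 z = d * tinvb d1 z"
proof -
  have "k w * (h w * tinvb d2 w) = k w * (d * h w * tinvb d1 w)" if w: "cmod w = 1" for w
  proof -
    have "((\<lambda>n. k w * (snd (M n w *\<^sub>2 jphib d1 w n) * w powi (- n))) \<longlongrightarrow>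
        k w * (d * h w * tinvb d1 w)) at_top"
    proof (rule M_top_snd[OF w])
      have "1 \<le> cmod w" using w by simp
      then show "is_sol S w (jphib d1 w)"
        using jost(1) unfolding jost_solutions_def by blast
      show "((\<lambda>n. snd (jphib d1 w n) * w powi (- n)) \<longlongrightarrow> tinvb d1 w) at_top"
        using trans(1) w unfolding transmission_def by blast
    qed
    moreover have "((\<lambda>n. snd (jphib d2 w n) * w powi (- n)) \<longlongrightarrow> tinvb d2 w) at_top"
      using trans(2) w unfolding transmission_def by blast
    then have "((\<lambda>n. k w * (h w * (snd (jphib d2 w n) * w powi (- n)))) \<longlongrightarrow>
        k w * (h w * tinvb d2 w)) at_top"
      by (intro tendsto_mult_left)
    ultimately show ?thesis
      unfolding circle_eqs(3)[OF w] cscale_def snd_conv mult.assoc[of "h w"]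
      by - (rule tendsto_unique[OF trivial_limit_at_top_linorder])
  qed
  moreover have "outer_ext (tinvb d1)" "outer_ext (tinvb d2)"
    using trans unfolding transmission_def by blast+
  then have "outer_ext (\<lambda>z. k z * (h z * tinvb d2 z))" "outer_ext (\<lambda>z. k z * (d * h z * tinvb d1 z))"
    using outer_ext_mult[OF hk_ext(4) outer_ext_mult[OF hk_ext(2)]]
      outer_ext_mult[OF hk_ext(4) outer_ext_mult[OF outer_ext_mult[OF outer_ext_const hk_ext(2)]]]
    by blast+
  ultimately have "k z * (h z * tinvb d2 z) = k z * (d * h z * tinvb d1 z)"
    using outer_ext_eqI[of "\<lambda>z. k z * (h z * tinvb d2 z)" "\<lambda>z. k z * (d * h z * tinvb d1 z)" z] z
    by simp
  moreover have "z \<noteq> 0" using z by auto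
  then have "k z \<noteq> 0" "h z \<noteq> 0" using hk_nz[of z] z by auto
  ultimately show ?thesis by simp
qed

context
  fixes N Nb :: nat and zs zbs :: "nat \<Rightarrow> complex" and ms mbs :: "nat \<Rightarrow> nat"
  assumes cfg: "pole_config N zs ms Nb zbs mbs"
    and poles: "has_poles d1 N zs ms Nb zbs mbs"
    and dep: "dependency d1 N zs ms Nb zbs mbs" "dependency d2 N zs ms Nb zbs mbs"
begin

text \<open>An instance of \<open>norm_series_transfer\<close> with factor 1 for
  \<open>jphi\<close>, factor \<open>d * h\<close> for \<open>jpsi\<close>, and the transmission
  coefficient divided by \<open>e\<close>.\<close>

lemma Cblk_gauge:
  assumes j: "j \<in> {1..N}"
  shows "Cblk d2 zs ms j = (d / e) \<cdot>\<^sub>m coeff_row (ms j)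
    (fps_expansion h (zs j) * norm_series (- 2) (ms j) (tres d1 zs j) (gam d1 j))"
proof -
  define U where "U = {z :: complex. 0 < cmod z \<and> cmod z < 1}"
  have "U = ball 0 1 - {0}" by (auto simp: U_def)
  then have U: "open U" "zs j \<in> U"
    using cfg j by (auto simp: U_def pole_config_def)
  have hol: "f holomorphic_on U" if "inner_ext f" for f
    using that by (simp add: U_def inner_ext_def)
  obtain n where n: "snd (jpsi d2 (zs j) n) \<noteq> 0"
  proof (rule inner_jost_nonzero[where w = "jpsi d2" and ?z0.0 = "zs j"])
    show "is_sol (sysU a b) z (jpsi d2 z)" if "cmod z = 1" for z
      using that by (intro sols) auto
  qed (use U jost_ext(10) jost_solutionsD(1)[OF jost(2)] in \<open>auto simp: U_def\<close>)
  have fin: "finite {z \<in> U. tinv d1 z = 0}"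
  proof -
    have "{z \<in> U. tinv d1 z = 0} = (\<Union>j\<in>{1..N}. {zs j, - zs j})"
      using poles by (simp add: has_poles_def U_def)
    then show ?thesis by simp
  qed
  have "tinv d1 holomorphic_on U"
    using trans(1) by (intro hol) (simp add: transmission_def)
  note residue = residue_scaled_denominator[OF U this fin, where g = "tinv d2"]
  have t: "tres d2 zs j k = tres d1 zs j k / e" for k
    unfolding tres_def
    by (rule residue) (simp add: U_def tinv_eq)
  have "coeff_row (ms j) (fps_expansion (\<lambda>w. 1) (zs j) *
      norm_series (- 2) (ms j) (tres d2 zs j) (gam d2 j)) =
    coeff_row (ms j) (fps_const (1 / e) * (fps_expansion (\<lambda>w. d * h w) (zs j) *
      norm_series (- 2) (ms j) (tres d1 zs j) (gam d1 j)))"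
  proof (rule norm_series_transfer[OF U])
    show "1 * snd (jphi d2 w n) = fst (snd (M n w)) * fst (jphi d1 w n) + snd (snd (M n w)) * snd (jphi d1 w n)"
      "d * h w * snd (jpsi d2 w n) =
        fst (snd (M n w)) * fst (jpsi d1 w n) + snd (snd (M n w)) * snd (jpsi d1 w n)" if "w \<in> U" for w
      using inner_eqs[of w n] that by (auto simp: U_def)
  qed (use j dep n t in \<open>auto intro!: hol jost_ext M_ext hk_ext inner_ext_mult inner_ext_const
      simp: dependency_def\<close>)
  moreover have "fps_expansion (\<lambda>w. d * h w) (zs j) = fps_const d * fps_expansion h (zs j)"
    using hol[OF hk_ext(1)] U analytic_at by (subst fps_expansion_mult) auto
  moreover have "fps_const (d / e) = fps_const (1 / e) * fps_const d" by simp
  ultimately show ?thesis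
    unfolding Cblk_eq_coeff_row coeff_row_smult[symmetric] by (simp only: fps_expansion_const
        fps_const_1_eq_1 mult_1_left mult.assoc)
qed

text \<open>Now \<open>jphib\<close> carries \<open>h\<close> and \<open>jpsib\<close> carries
  \<open>e\<close>, so \<open>h\<close> multiplies the series of the target system.\<close>

lemma Cblkb_gauge:
  assumes j: "j \<in> {1..Nb}"
  shows "coeff_row (mbs j) (fps_expansion h (zbs j) *
      norm_series 2 (mbs j) (tresb d2 zbs j) (gamb d2 j)) = (e / d) \<cdot>\<^sub>m Cblkb d1 zbs mbs j"
proof -
  define U where "U = {z :: complex. 1 < cmod z}"
  have "U = - cball 0 1" by (auto simp: U_def)
  then have U: "open U" "zbs j \<in> U"
    using cfg j by (auto simp: U_def pole_config_def)
  have hol: "f holomorphic_on U" if "outer_ext f" for f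
    using that by (simp add: U_def outer_ext_def)
  obtain n where n: "fst (jpsib d2 (zbs j) n) \<noteq> 0"
  proof (rule outer_jost_nonzero[where w = "jpsib d2" and ?z0.0 = "zbs j"])
    show "is_sol (sysU a b) z (jpsib d2 z)" if "cmod z = 1" for z
      using that by (intro sols) auto
  qed (use U jost_ext(13) jost_solutionsD(2)[OF jost(2)] in \<open>auto simp: U_def\<close>)
  have fin: "finite {z \<in> U. tinvb d1 z = 0}"
  proof -
    have "{z \<in> U. tinvb d1 z = 0} = (\<Union>j\<in>{1..Nb}. {zbs j, - zbs j})"
      using poles by (simp add: has_poles_def U_def)
    then show ?thesis by simp
  qed
  have "tinvb d1 holomorphic_on U"
    using trans(1) by (intro hol) (simp add: transmission_def)
  note residue = residue_scaled_denominator[OF U this fin, where g = "tinvb d2"]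
  have t: "tresb d2 zbs j k = tresb d1 zbs j k / d" for k
    unfolding tresb_def
    by (rule residue) (simp add: U_def tinvb_eq)
  have "coeff_row (mbs j) (fps_expansion h (zbs j) *
      norm_series 2 (mbs j) (tresb d2 zbs j) (gamb d2 j)) =
    coeff_row (mbs j) (fps_const (1 / d) * (fps_expansion (\<lambda>w. e) (zbs j) *
      norm_series 2 (mbs j) (tresb d1 zbs j) (gamb d1 j)))"
  proof (rule norm_series_transfer[OF U])
    show "h w * fst (jphib d2 w n) = fst (fst (M n w)) * fst (jphib d1 w n) + snd (fst (M n w)) * snd (jphib d1 w n)"
      "e * fst (jpsib d2 w n) =
        fst (fst (M n w)) * fst (jpsib d1 w n) + snd (fst (M n w)) * snd (jpsib d1 w n)" if "w \<in> U" for w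
      using outer_eqs[of w n] that by (auto simp: U_def)
  qed (use j dep n t in \<open>auto intro!: hol jost_ext M_ext hk_ext outer_ext_const
      simp: dependency_def\<close>)
  moreover have "fps_const (e / d) = fps_const (1 / d) * fps_const e" by simp
  ultimately show ?thesis
    unfolding Cblk_eq_coeff_row coeff_row_smult[symmetric]
    by (simp only: fps_expansion_const mult.assoc)
qed

end

end

end

section \<open>Gauge transformations from system (Q) to system (U)\<close>

text \<open>Multiplication by a null sequence absorbs the mismatch between the phases \<open>z ^ n\<close> and
  \<open>z ^ (- n)\<close> of the two components.\<close>

lemma tendsto_zero_phase:
  fixes f c c' p :: "int \<Rightarrow> complex"
  assumes lim: "((\<lambda>n. f n * c n) \<longlongrightarrow> l) F"
    and c: "\<And>n. cmod (c n) = 1" "\<And>n. cmod (c' n) = 1" and p: "(p \<longlongrightarrow> 0) F"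
  shows "((\<lambda>n. p n * f n * c' n) \<longlongrightarrow> 0) F"
proof -
  have "((\<lambda>n. cmod (p n * (f n * c n))) \<longlongrightarrow> cmod (0 * l)) F"
    by (intro tendsto_intros p lim)
  then have "((\<lambda>n. cmod (p n * f n * c' n)) \<longlongrightarrow> 0) F"
    by (simp add: norm_mult c)
  then show ?thesis by (rule tendsto_norm_zero_cancel)
qed

locale decaying_potentials =
  fixes q r :: "int \<Rightarrow> complex"
  assumes decay: "rapid_decay q" "rapid_decay r"
    and D_factor_nz: "\<And>n. 1 - q n * r n \<noteq> 0" and E_factor_nz: "\<And>n. 1 + q n * r (n + 1) \<noteq> 0"
begin

abbreviation "D \<equiv> Dn q r"
abbreviation "E \<equiv> En q r"

lemma summ_q: "abs_summable q" and summ_r: "abs_summable r"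
  by (rule rapid_decay_imp_abs_summable[OF decay(1)] rapid_decay_imp_abs_summable[OF decay(2)])+

lemma summ_r': "abs_summable (\<lambda>n. r (n + 1))" and summ_q': "abs_summable (\<lambda>n. q (n + 1))"
  by (rule abs_summable_shift[OF summ_r] abs_summable_shift[OF summ_q])+

lemma bounded_qr:
  obtains C where "\<And>n. cmod (q n) \<le> C" "\<And>n. cmod (r n) \<le> C"
proof -
  obtain A where A: "\<And>n. cmod (q n) \<le> A"
    using bounded_if_tendsto_at_top_at_bot[OF tendsto_zero_if_abs_summable[OF summ_q]] by blast
  obtain B where B: "\<And>n. cmod (r n) \<le> B"
    using bounded_if_tendsto_at_top_at_bot[OF tendsto_zero_if_abs_summable[OF summ_r]] by blast
  show ?thesis
    by (rule that[of "max A B"]) (simp_all add: le_max_iff_disj A B)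
qed

lemma qr_tendsto_zero:
  "(q \<longlongrightarrow> 0) at_top" "(q \<longlongrightarrow> 0) at_bot" "(r \<longlongrightarrow> 0) at_top" "(r \<longlongrightarrow> 0) at_bot"
  by (intro tendsto_zero_if_abs_summable summ_q summ_r)+

sublocale DP: nonzero_product "\<lambda>j. 1 - q j * r j"
proof
  obtain C where C: "\<And>n. cmod (q n) \<le> C" "\<And>n. cmod (r n) \<le> C"
    using bounded_qr by blast
  show "abs_summable (\<lambda>n. 1 - q n * r n - 1)"
    using abs_summable_mult_bounded[OF summ_q, of r, OF C(2)] by simp
qed (rule D_factor_nz)

sublocale EP: nonzero_product "\<lambda>j. 1 + q j * r (j + 1)"
proof
  obtain C where C: "\<And>n. cmod (q n) \<le> C" "\<And>n. cmod (r n) \<le> C"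
    using bounded_qr by blast
  show "abs_summable (\<lambda>n. 1 + q n * r (n + 1) - 1)"
    using abs_summable_mult_bounded[OF summ_q, of "\<lambda>n. r (n + 1)", OF C(2)] by simp
qed (rule E_factor_nz)

lemma D_nz: "D n \<noteq> 0" and E_nz: "E n \<noteq> 0"
  unfolding Dn_def En_def by (rule DP.prod_upto_nonzero EP.prod_upto_nonzero)+

lemma D_rec: "D n = D (n - 1) * (1 - q n * r n)" and E_rec: "E n = E (n - 1) * (1 + q n * r (n + 1))"
  unfolding Dn_def En_def by (rule DP.prod_upto_rec EP.prod_upto_rec)+

lemma Dinf_nz: "Dinf q r \<noteq> 0" and Einf_nz: "Einf q r \<noteq> 0"
  unfolding Dinf_def Einf_def by (rule DP.prod_all_nonzero EP.prod_all_nonzero)+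

lemma DE_tendsto:
  "(D \<longlongrightarrow> Dinf q r) at_top" "(D \<longlongrightarrow> 1) at_bot" "(E \<longlongrightarrow> Einf q r) at_top" "(E \<longlongrightarrow> 1) at_bot"
  unfolding Dn_def En_def Dinf_def Einf_def
  by (rule DP.prod_upto_at_top DP.prod_upto_at_bot EP.prod_upto_at_top EP.prod_upto_at_bot)+

lemma DE_shift_tendsto:
  "((\<lambda>n. D (n - 1)) \<longlongrightarrow> Dinf q r) at_top" "((\<lambda>n. D (n - 1)) \<longlongrightarrow> 1) at_bot"
  "((\<lambda>n. E (n - 1)) \<longlongrightarrow> Einf q r) at_top" "((\<lambda>n. E (n - 1)) \<longlongrightarrow> 1) at_bot"
  by (rule filterlim_compose[OF DE_tendsto(1) filterlim_diff_const_int(1)]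
      filterlim_compose[OF DE_tendsto(2) filterlim_diff_const_int(2)]
      filterlim_compose[OF DE_tendsto(3) filterlim_diff_const_int(1)]
      filterlim_compose[OF DE_tendsto(4) filterlim_diff_const_int(2)])+

lemma abs_summable_quotient:
  assumes f: "abs_summable f"
  shows "abs_summable (\<lambda>n. f n * E (n - 1) / D (n + c))" "abs_summable (\<lambda>n. f n * D (n + c) / E n)"
proof -
  obtain A where A: "\<And>n. cmod (D n) \<le> A"
    using DP.prod_upto_bounded unfolding Dn_def by blast
  obtain A' where A': "\<And>n. cmod (inverse (D n)) \<le> A'"
    using DP.inverse_prod_upto_bounded unfolding Dn_def by blast
  obtain B where B: "\<And>n. cmod (E n) \<le> B"
    using EP.prod_upto_bounded unfolding En_def by blast
  obtain B' where B': "\<And>n. cmod (inverse (E n)) \<le> B'"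
    using EP.inverse_prod_upto_bounded unfolding En_def by blast
  have "abs_summable (\<lambda>n. f n * E (n - 1))"
    by (rule abs_summable_mult_bounded[OF f]) (rule B)
  from abs_summable_mult_bounded[OF this, of "\<lambda>n. inverse (D (n + c))", OF A']
  show "abs_summable (\<lambda>n. f n * E (n - 1) / D (n + c))"
    by (simp add: divide_inverse)
  have "abs_summable (\<lambda>n. f n * D (n + c))"
    by (rule abs_summable_mult_bounded[OF f]) (rule A)
  from abs_summable_mult_bounded[OF this, of "\<lambda>n. inverse (E n)", OF B']
  show "abs_summable (\<lambda>n. f n * D (n + c) / E n)"
    by (simp add: divide_inverse)
qed

lemma abs_summable_combine:
  assumes f: "abs_summable f" and g: "abs_summable g" and p: "abs_summable p"
    and le: "\<And>n. cmod (F n) \<le> cmod (f n) + cmod (g n) + cmod (p n)"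
  shows "abs_summable F"
  by (rule Infinite_Sum.abs_summable_on_comparison_test'[OF summable_on_add[OF summable_on_add[OF f g] p] le])

lemma summ_v_factor: "abs_summable (\<lambda>n. - r n + r (n + 1) - q n * r n * r (n + 1))"
  and summ_p_factor: "abs_summable (\<lambda>n. q n - q (n + 1) - q n * q (n + 1) * r (n + 1))"
proof -
  obtain C where C: "\<And>n. cmod (q n) \<le> C" "\<And>n. cmod (r n) \<le> C"
    using bounded_qr by blast
  have "abs_summable (\<lambda>n. q n * r n * r (n + 1))" "abs_summable (\<lambda>n. q n * q (n + 1) * r (n + 1))"
    by (rule abs_summable_mult_bounded[OF abs_summable_mult_bounded[OF summ_q]]; rule C)+
  note s = this
  have tri: "cmod (x - y - w) \<le> cmod x + cmod y + cmod w" for x y w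
    using norm_triangle_ineq4[of "x - y" w] norm_triangle_ineq4[of x y] by simp
  show "abs_summable (\<lambda>n. - r n + r (n + 1) - q n * r n * r (n + 1))"
    by (rule abs_summable_combine[OF summ_r' summ_r s(1)]) (use tri in simp)
  show "abs_summable (\<lambda>n. q n - q (n + 1) - q n * q (n + 1) * r (n + 1))"
    by (rule abs_summable_combine[OF summ_q summ_q' s(2)]) (use tri in simp)
qed

text \<open>The relation \<open>1 - u v = 1 / ((1 - q_n r_n) (1 + q_n r_(n+1)))\<close> gives
  invertibility of the steps, and boundedness of the products and their reciprocals gives
  summability.\<close>

sublocale UV: summable_potentials "pot_u q r" "pot_v q r"
proof
  show "abs_summable (pot_u q r)"
    using abs_summable_quotient(1)[OF summ_q, of 0] by (simp add: pot_u_def[abs_def])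
  show "abs_summable (pot_v q r)"
    using abs_summable_quotient(2)[OF summ_v_factor, of "- 1"] by (simp add: pot_v_def[abs_def])
  fix n
  have "pot_u q r n * pot_v q r n =
      q n * (- r n + r (n + 1) - q n * r n * r (n + 1)) / ((1 - q n * r n) * (1 + q n * r (n + 1)))"
    unfolding pot_u_def pot_v_def D_rec[of n] E_rec[of n]
    using D_nz[of "n - 1"] E_nz[of "n - 1"] D_factor_nz[of n] E_factor_nz[of n]
    by (simp add: divide_simps)
  moreover have "(1 - q n * r n) * (1 + q n * r (n + 1)) -
      q n * (- r n + r (n + 1) - q n * r n * r (n + 1)) = 1"
    by (simp add: algebra_simps)
  ultimately show "pot_u q r n * pot_v q r n \<noteq> 1"
    using D_factor_nz[of n] E_factor_nz[of n] by (auto simp: divide_eq_1_iff)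
qed

sublocale PS: summable_potentials "pot_p q r" "pot_s q r"
proof
  show "abs_summable (pot_p q r)"
    using abs_summable_quotient(1)[OF summ_p_factor, of 1] by (simp add: pot_p_def[abs_def])
  show "abs_summable (pot_s q r)"
    using abs_summable_quotient(2)[OF summ_r', of 0] by (simp add: pot_s_def[abs_def])
  fix n
  have D': "D (n + 1) = D n * (1 - q (n + 1) * r (n + 1))"
    using D_rec[of "n + 1"] by simp
  have "pot_p q r n * pot_s q r n = (q n - q (n + 1) - q n * q (n + 1) * r (n + 1)) * r (n + 1) /
      ((1 - q (n + 1) * r (n + 1)) * (1 + q n * r (n + 1)))"
    unfolding pot_p_def pot_s_def D' E_rec[of n]
    using D_nz[of n] E_nz[of "n - 1"] D_factor_nz[of "n + 1"] E_factor_nz[of n]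
    by (simp add: divide_simps)
  moreover have "(1 - q (n + 1) * r (n + 1)) * (1 + q n * r (n + 1)) -
      (q n - q (n + 1) - q n * q (n + 1) * r (n + 1)) * r (n + 1) = 1"
    by (simp add: algebra_simps)
  ultimately show "pot_p q r n * pot_s q r n \<noteq> 1"
    using D_factor_nz[of "n + 1"] E_factor_nz[of n] by (auto simp: divide_eq_1_iff)
qed

section \<open>The two gauge matrices and the systems they lead to\<close>

definition gaugeUV :: "int \<Rightarrow> complex \<Rightarrow> matrix2" where
  "gaugeUV n z = ((E (n - 1), 0), (- (D (n - 1) * r n), D (n - 1) * (1 - inverse z * inverse z)))"

text \<open>This is the overview's formula with \<open>B\<close> expanded. The determinant
  \<open>E (n - 1) * D n\<close> is the same for all \<open>z\<close>, in accordance with the factor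
  \<open>h = 1\<close> of this gauge.\<close>

definition gaugePS :: "int \<Rightarrow> complex \<Rightarrow> matrix2" where
  "gaugePS n z = ((E (n - 1) * (1 - q n * r n), E (n - 1) * q n), (- (D n * r n), D n))"

lemma sol_shift:
  assumes "is_sol (sysQ q r) z w" "z \<noteq> 0"
  shows "snd (w n) - r n * fst (w n) = inverse z * snd (w (n + 1))"
proof -
  have "w n = sysQ q r z n (w (n + 1))"
    using assms(1) unfolding is_sol_def by (rule spec)
  then show ?thesis
    using assms(2) by (simp add: sysQ_def algebra_simps)
qed

lemma gaugeUV_sol:
  assumes z: "z \<noteq> 0" and sol: "is_sol (sysQ q r) z w"
  shows "is_sol (sysU (pot_u q r) (pot_v q r)) z (\<lambda>n. gaugeUV n z *\<^sub>2 w n)"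
  unfolding is_sol_def
proof
  fix n
  define x y where "x = fst (w (n + 1))" and "y = snd (w (n + 1))"
  define i where "i = inverse z"
  have zi: "z * i = 1" using z by (simp add: i_def)
  have "w n = sysQ q r z n (w (n + 1))"
    using sol unfolding is_sol_def by (rule spec)
  then have w: "fst (w n) = z * x + (z - i) * q n * y"
    "snd (w n) = z * r n * x + (i + (z - i) * q n * r n) * y"
    by (simp_all add: sysQ_def x_def y_def i_def)
  have nz: "D (n - 1) \<noteq> 0" "E (n - 1) \<noteq> 0" "1 - q n * r n \<noteq> 0" "1 + q n * r (n + 1) \<noteq> 0"
    by (rule D_nz E_nz D_factor_nz E_factor_nz)+
  have u: "pot_u q r n * D n = q n * E (n - 1)" and v: "pot_v q r n * E n =
      (- r n + r (n + 1) - q n * r n * r (n + 1)) * D (n - 1)"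
    using D_nz[of n] E_nz[of n] by (simp_all add: pot_u_def pot_v_def)
  \<comment> \<open>\<open>D n * H\<close> is the second gauged component at
    \<open>n + 1\<close>.\<close>
  define H where "H = (1 - i * i) * y - r (n + 1) * x"
  have "z * (E n * x) + z * (pot_u q r n * D n) * H = z * E (n - 1) * (x + q n * (r (n + 1) * x + H))"
    unfolding u E_rec[of n] by (simp add: algebra_simps)
  also have "\<dots> = E (n - 1) * (z * x + (z * 1 - (z * i) * i) * q n * y)"
    unfolding H_def by (simp add: algebra_simps)
  finally have 1: "E (n - 1) * fst (w n) = z * (E n * x) + z * pot_u q r n * (D n * H)"
    unfolding w zi by (simp add: mult.assoc)
  have "i * (pot_v q r n * E n) * x + i * (D n * H) =
      i * D (n - 1) * ((- r n + (1 - q n * r n) * r (n + 1)) * x + (1 - q n * r n) * H)"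
    unfolding v D_rec[of n] by (simp add: algebra_simps)
  also have "\<dots> = i * D (n - 1) * (- r n * x + (1 - q n * r n) * (1 - i * i) * y)"
    unfolding H_def by (simp add: algebra_simps)
  also have "\<dots> = D (n - 1) * ((1 - i * i) * snd (w n) - r n * fst (w n))"
  proof -
    \<comment> \<open>The identity holds modulo \<open>z * i = 1\<close>; writing the discrepancy as
      an explicit multiple of \<open>1 - z * i\<close> makes it a polynomial identity.\<close>
    have "(1 - i * i) * snd (w n) - r n * fst (w n) =
        i * (- r n * x + (1 - q n * r n) * (1 - i * i) * y) +
        (1 - z * i) * (i * r n * x + i * q n * r n * y)"
      unfolding w by (simp add: algebra_simps)
    then show ?thesis unfolding zi by simp
  qed
  finally have 2: "D (n - 1) * ((1 - i * i) * snd (w n) - r n * fst (w n)) =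
      i * pot_v q r n * (E n * x) + i * (D n * H)"
    by (simp add: mult.assoc)
  show "gaugeUV n z *\<^sub>2 w n =
      sysU (pot_u q r) (pot_v q r) z n (gaugeUV (n + 1) z *\<^sub>2 w (n + 1))"
    using 1 2 by (simp add: prod_eq_iff mult_vec2_def gaugeUV_def sysU_def x_def y_def i_def H_def
        algebra_simps)
qed

lemma gaugePS_sol:
  assumes z: "z \<noteq> 0" and sol: "is_sol (sysQ q r) z w"
  shows "is_sol (sysU (pot_p q r) (pot_s q r)) z (\<lambda>n. gaugePS n z *\<^sub>2 w n)"
  unfolding is_sol_def
proof
  fix n
  define x where "x = fst (w (n + 1))"
  define B where "B = (\<lambda>n. snd (w n) - r n * fst (w n))"
  define G where "G = (\<lambda>n. fst (w n) + q n * B n)"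
  define i where "i = inverse z"
  have zi: "z * i = 1" using z by (simp add: i_def)
  have "w n = sysQ q r z n (w (n + 1))"
    using sol unfolding is_sol_def by (rule spec)
  then have w: "fst (w n) = z * x + (z - i) * q n * snd (w (n + 1))"
    by (simp add: sysQ_def x_def i_def)
  have B_n: "B n = i * snd (w (n + 1))"
    unfolding B_def i_def by (rule sol_shift[OF sol z])
  \<comment> \<open>These equations invert the change of variables at \<open>n + 1\<close>, so that
    the recurrence can be written in \<open>G\<close> and \<open>B\<close> alone.\<close>
  have y: "snd (w (n + 1)) = B (n + 1) + r (n + 1) * x"
    by (simp add: B_def x_def)
  have x: "x = G (n + 1) - q (n + 1) * B (n + 1)"
    by (simp add: G_def x_def)
  have D': "D (n + 1) = D n * (1 - q (n + 1) * r (n + 1))"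
    using D_rec[of "n + 1"] by simp
  have p: "pot_p q r n * D (n + 1) = (q n - q (n + 1) - q n * q (n + 1) * r (n + 1)) * E (n - 1)"
    and s: "pot_s q r n * E n = r (n + 1) * D n"
    using D_nz[of "n + 1"] E_nz[of n] by (simp_all add: pot_p_def pot_s_def)
  have "E (n - 1) * G n = E (n - 1) * (z * x + z * q n * snd (w (n + 1)))"
    unfolding G_def w B_n by (simp add: algebra_simps)
  also have "\<dots> = z * (E n * G (n + 1)) + z * (pot_p q r n * D (n + 1)) * B (n + 1)"
    unfolding y x p E_rec[of n] by (simp add: algebra_simps)
  finally have 1: "E (n - 1) * G n = z * (E n * G (n + 1)) + z * pot_p q r n * (D (n + 1) * B (n + 1))"
    by (simp add: mult.assoc)
  have "D n * B n = i * (pot_s q r n * E n) * G (n + 1) + i * (D (n + 1) * B (n + 1))"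
    unfolding B_n y x s D' by (simp add: algebra_simps)
  then have 2: "D n * B n = i * pot_s q r n * (E n * G (n + 1)) + i * (D (n + 1) * B (n + 1))"
    by (simp add: mult.assoc)
  have "gaugePS n z *\<^sub>2 w n = (E (n - 1) * G n, D n * B n)" for n
    by (simp add: mult_vec2_def gaugePS_def G_def B_def algebra_simps)
  then show "gaugePS n z *\<^sub>2 w n =
      sysU (pot_p q r) (pot_s q r) z n (gaugePS (n + 1) z *\<^sub>2 w (n + 1))"
    using 1 2 by (simp add: sysU_def i_def mult.assoc)
qed

section \<open>Asymptotics of gauged solutions\<close>

lemma gaugeUV_limit:
  assumes z: "cmod z = 1" and w: "jost_limit z w v F" and r: "(r \<longlongrightarrow> 0) F"
    and E: "((\<lambda>n. E (n - 1)) \<longlongrightarrow> e) F" and D: "((\<lambda>n. D (n - 1)) \<longlongrightarrow> d) F"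
  shows "jost_limit z (\<lambda>n. gaugeUV n z *\<^sub>2 w n)
    (e * fst v, d * (1 - inverse z * inverse z) * snd v) F"
proof -
  have l: "((\<lambda>n. fst (w n) * z powi n) \<longlongrightarrow> fst v) F" "((\<lambda>n. snd (w n) * z powi (- n)) \<longlongrightarrow> snd v) F"
    using w unfolding jost_limit_def by blast+
  have "((\<lambda>n. r n * fst (w n) * z powi (- n)) \<longlongrightarrow> 0) F"
    by (rule tendsto_zero_phase[OF l(1) norm_powi_eq_1[OF z] norm_powi_eq_1[OF z] r])
  then have "((\<lambda>n. D (n - 1) * ((1 - inverse z * inverse z) * (snd (w n) * z powi (- n)) -
      r n * fst (w n) * z powi (- n))) \<longlongrightarrow> d * ((1 - inverse z * inverse z) * snd v - 0)) F"
    by (intro tendsto_mult tendsto_diff tendsto_const D l)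
  moreover have "((\<lambda>n. E (n - 1) * (fst (w n) * z powi n)) \<longlongrightarrow> e * fst v) F"
    by (intro tendsto_mult E l)
  ultimately show ?thesis
    by (simp add: jost_limit_def mult_vec2_def gaugeUV_def algebra_simps)
qed

lemma gaugePS_limit:
  assumes z: "cmod z = 1" and w: "jost_limit z w v F" and q: "(q \<longlongrightarrow> 0) F" and r: "(r \<longlongrightarrow> 0) F"
    and E: "((\<lambda>n. E (n - 1)) \<longlongrightarrow> e) F" and D: "(D \<longlongrightarrow> d) F"
  shows "jost_limit z (\<lambda>n. gaugePS n z *\<^sub>2 w n) (e * fst v, d * snd v) F"
proof -
  have l: "((\<lambda>n. fst (w n) * z powi n) \<longlongrightarrow> fst v) F" "((\<lambda>n. snd (w n) * z powi (- n)) \<longlongrightarrow> snd v) F"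
    using w unfolding jost_limit_def by blast+
  have "((\<lambda>n. r n * fst (w n) * z powi (- n)) \<longlongrightarrow> 0) F" "((\<lambda>n. q n * snd (w n) * z powi n) \<longlongrightarrow> 0) F"
    by (rule tendsto_zero_phase[OF l(1) norm_powi_eq_1[OF z] norm_powi_eq_1[OF z] r]
        tendsto_zero_phase[OF l(2) norm_powi_eq_1[OF z] norm_powi_eq_1[OF z] q])+
  note l' = this
  have "((\<lambda>n. D n * (snd (w n) * z powi (- n) - r n * fst (w n) * z powi (- n))) \<longlongrightarrow> d * (snd v - 0)) F"
    by (intro tendsto_mult tendsto_diff D l l')
  moreover have "((\<lambda>n. E (n - 1) * ((1 - q n * r n) * (fst (w n) * z powi n) + q n * snd (w n) * z powi n))
      \<longlongrightarrow> e * ((1 - 0 * 0) * fst v + 0)) F"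
    by (intro tendsto_mult tendsto_add tendsto_diff tendsto_const E q r l l')
  ultimately show ?thesis
    by (simp add: jost_limit_def mult_vec2_def gaugePS_def algebra_simps)
qed

lemma gaugeUV_top_fst:
  assumes "((\<lambda>n. fst (w n) * z powi n) \<longlongrightarrow> l) at_top"
  shows "((\<lambda>n. fst (gaugeUV n z *\<^sub>2 w n) * z powi n) \<longlongrightarrow> Einf q r * l) at_top"
  using tendsto_mult[OF DE_shift_tendsto(3) assms] by (simp add: mult_vec2_def gaugeUV_def mult.assoc)

text \<open>By the second equation of the system, \<open>r n * fst (w n)\<close> is a difference of two consecutive
  second components up to a phase, so it tends to zero without any bound on \<open>fst (w n)\<close>.\<close>

lemma tendsto_shifted_snd:
  assumes z: "cmod z = 1" and sol: "is_sol (sysQ q r) z w"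
    and lim: "((\<lambda>n. snd (w n) * z powi (- n)) \<longlongrightarrow> l) at_top"
  shows "((\<lambda>n. (snd (w n) - r n * fst (w n)) * z powi (- n)) \<longlongrightarrow> l) at_top"
proof -
  have nz: "z \<noteq> 0" using z by auto
  have "(snd (w n) - r n * fst (w n)) * z powi (- n) = snd (w (n + 1)) * z powi (- (n + 1))" for n
  proof -
    have "- (n + 1) = - n - 1" by simp
    then have "z powi (- (n + 1)) = z powi (- n) * inverse z"
      using nz by (simp only: power_int_diff divide_inverse power_int_1_right simp_thms)
    then show ?thesis
      unfolding sol_shift[OF sol nz] by (simp only: mult_ac)
  qed
  then show ?thesis
    using filterlim_compose[OF lim filterlim_add_const_int_at_top[of 1]] by simp
qed

text \<open>The component splits into \<open>beta - r alpha\<close> minus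
  \<open>z^(-2) beta\<close>, and both have the limit \<open>l\<close> up to their constant factor;
  no control of \<open>alpha\<close> is required.\<close>

lemma gaugeUV_top_snd:
  assumes z: "cmod z = 1" and sol: "is_sol (sysQ q r) z w"
    and lim: "((\<lambda>n. snd (w n) * z powi (- n)) \<longlongrightarrow> l) at_top"
  shows "((\<lambda>n. snd (gaugeUV n z *\<^sub>2 w n) * z powi (- n)) \<longlongrightarrow>
    Dinf q r * (1 - inverse z * inverse z) * l) at_top"
proof -
  have "((\<lambda>n. D (n - 1) * ((snd (w n) - r n * fst (w n)) * z powi (- n) -
      inverse z * inverse z * (snd (w n) * z powi (- n)))) \<longlongrightarrow>
      Dinf q r * (l - inverse z * inverse z * l)) at_top"
    by (intro tendsto_mult tendsto_diff tendsto_const DE_shift_tendsto lim tendsto_shifted_snd[OF assms])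
  then show ?thesis
    by (simp add: mult_vec2_def gaugeUV_def algebra_simps)
qed

lemma gaugePS_top_snd:
  assumes z: "cmod z = 1" and sol: "is_sol (sysQ q r) z w"
    and lim: "((\<lambda>n. snd (w n) * z powi (- n)) \<longlongrightarrow> l) at_top"
  shows "((\<lambda>n. snd (gaugePS n z *\<^sub>2 w n) * z powi (- n)) \<longlongrightarrow> Dinf q r * l) at_top"
  using tendsto_mult[OF DE_tendsto(1) tendsto_shifted_snd[OF assms]]
  by (simp add: mult_vec2_def gaugePS_def algebra_simps)

text \<open>The first equation expresses \<open>(1 - z ^ (- 2)) * q n * snd (w (n + 1))\<close> through consecutive first
  components; this is why the limit is only available after multiplication by that factor.\<close>

lemma gaugePS_top_fst:
  assumes z: "cmod z = 1" and sol: "is_sol (sysQ q r) z w"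
    and lim: "((\<lambda>n. fst (w n) * z powi n) \<longlongrightarrow> l) at_top"
  shows "((\<lambda>n. (1 - inverse z * inverse z) * (fst (gaugePS n z *\<^sub>2 w n) * z powi n)) \<longlongrightarrow>
    (1 - inverse z * inverse z) * (Einf q r * l)) at_top"
proof -
  define i where "i = inverse z"
  have nz: "z \<noteq> 0" using z by auto
  then have zi: "z * i = 1" by (simp add: i_def)
  have eq: "(1 - i * i) * (fst (gaugePS n z *\<^sub>2 w n) * z powi n) =
      E (n - 1) * ((1 - i * i) * (fst (w n) * z powi n) +
        i * i * (fst (w n) * z powi n - fst (w (n + 1)) * z powi (n + 1)))" for n
  proof -
    have "w n = sysQ q r z n (w (n + 1))"
      using sol unfolding is_sol_def by (rule spec)
    then have f: "fst (w n) = z * fst (w (n + 1)) + (z - i) * q n * snd (w (n + 1))"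
      by (simp add: sysQ_def i_def)
    have "fst (gaugePS n z *\<^sub>2 w n) =
        E (n - 1) * (fst (w n) + q n * (snd (w n) - r n * fst (w n)))"
      by (simp add: mult_vec2_def gaugePS_def algebra_simps)
    then have g: "fst (gaugePS n z *\<^sub>2 w n) = E (n - 1) * (fst (w n) + q n * (i * snd (w (n + 1))))"
      unfolding sol_shift[OF sol nz] i_def .
    have "(1 - i * i) * (q n * (i * snd (w (n + 1)))) =
        i * i * ((z - i) * q n * snd (w (n + 1))) + (1 - z * i) * (i * q n * snd (w (n + 1)))"
      by (simp add: algebra_simps)
    also have "\<dots> = i * i * (fst (w n) - z * fst (w (n + 1)))"
      unfolding f zi by simp
    finally have *: "(1 - i * i) * (q n * (i * snd (w (n + 1)))) = i * i * (fst (w n) - z * fst (w (n + 1)))" .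
    have "(1 - i * i) * (fst (gaugePS n z *\<^sub>2 w n) * z powi n) = E (n - 1) *
        ((1 - i * i) * fst (w n) + (1 - i * i) * (q n * (i * snd (w (n + 1))))) * z powi n"
      unfolding g by (simp add: algebra_simps)
    also have "\<dots> = E (n - 1) * ((1 - i * i) * (fst (w n) * z powi n) +
        i * i * (fst (w n) * z powi n - fst (w (n + 1)) * z powi (n + 1)))"
      unfolding * using nz by (simp add: power_int_add algebra_simps)
    finally show ?thesis .
  qed
  have "((\<lambda>n. E (n - 1) * ((1 - i * i) * (fst (w n) * z powi n) +
      i * i * (fst (w n) * z powi n - fst (w (n + 1)) * z powi (n + 1)))) \<longlongrightarrow>
      Einf q r * ((1 - i * i) * l + i * i * (l - l))) at_top"
    by (intro tendsto_mult tendsto_add tendsto_diff tendsto_const DE_shift_tendsto lim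
        filterlim_compose[OF lim filterlim_add_const_int_at_top])
  then show ?thesis
    unfolding eq[folded i_def, symmetric] i_def[symmetric] by (simp add: mult.left_commute)
qed

lemma one_minus_inverse_sq_ext:
  "inner_ext (\<lambda>z. 1 - inverse z * inverse z)" "outer_ext (\<lambda>z. 1 - inverse z * inverse z)"
  by (intro inner_ext_diff inner_ext_mult inner_ext_const inner_ext_inverse
      outer_ext_diff outer_ext_mult outer_ext_const outer_ext_inverse)+

lemma one_minus_inverse_sq_nz:
  assumes "cmod z \<noteq> 1"
  shows "1 - inverse z * inverse z \<noteq> 0"
proof
  assume "1 - inverse z * inverse z = 0"
  then have "cmod z ^ 2 = 1"
    by (cases "z = 0") (simp_all add: field_simps power2_eq_square flip: norm_mult)
  then show False using assms by (simp add: power2_eq_1_iff) (use norm_ge_zero[of z] in linarith)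
qed

sublocale gUV: gauge "pot_u q r" "pot_v q r" "sysQ q r" gaugeUV "\<lambda>z. 1 - inverse z * inverse z"
  "\<lambda>z. 1" "Einf q r" "Dinf q r"
proof
  fix z :: complex and w :: "int \<Rightarrow> complex \<times> complex" and v :: "complex \<times> complex" and l :: complex
  assume z: "cmod z = 1"
  show "jost_limit z (\<lambda>n. gaugeUV n z *\<^sub>2 w n) (fst v, (1 - inverse z * inverse z) * snd v) at_bot"
    if "jost_limit z w v at_bot"
    using gaugeUV_limit[OF z that qr_tendsto_zero(4) DE_shift_tendsto(4,2)] by simp
  show "jost_limit z (\<lambda>n. gaugeUV n z *\<^sub>2 w n)
      (Einf q r * fst v, Dinf q r * (1 - inverse z * inverse z) * snd v) at_top"
    if "jost_limit z w v at_top"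
    using gaugeUV_limit[OF z that qr_tendsto_zero(3) DE_shift_tendsto(3,1)] by simp
  show "((\<lambda>n. 1 * (fst (gaugeUV n z *\<^sub>2 w n) * z powi n)) \<longlongrightarrow> 1 * (Einf q r * l)) at_top"
    if "((\<lambda>n. fst (w n) * z powi n) \<longlongrightarrow> l) at_top"
    using gaugeUV_top_fst[OF that] by simp
  show "((\<lambda>n. 1 * (snd (gaugeUV n z *\<^sub>2 w n) * z powi (- n))) \<longlongrightarrow>
      1 * (Dinf q r * (1 - inverse z * inverse z) * l)) at_top"
    if "is_sol (sysQ q r) z w" "((\<lambda>n. snd (w n) * z powi (- n)) \<longlongrightarrow> l) at_top"
    using gaugeUV_top_snd[OF z that] by simp
qed (simp_all add: gaugeUV_def inner_ext_const outer_ext_const inner_ext_mult outer_ext_mult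
    one_minus_inverse_sq_ext one_minus_inverse_sq_nz[simplified]
    gaugeUV_sol[unfolded gaugeUV_def])

text \<open>Compared with the gauge to \<open>(u, v)\<close> the roles of \<open>h\<close> and
  \<open>k\<close> are exchanged: the matrix does not degenerate on the circle, but the limit of the
  first component is obtained only after multiplication by \<open>1 - z^(-2)\<close>.\<close>

sublocale gPS: gauge "pot_p q r" "pot_s q r" "sysQ q r" gaugePS "\<lambda>z. 1"
  "\<lambda>z. 1 - inverse z * inverse z" "Einf q r" "Dinf q r"
proof
  fix z :: complex and w :: "int \<Rightarrow> complex \<times> complex" and v :: "complex \<times> complex" and l :: complex
  assume z: "cmod z = 1"
  show "jost_limit z (\<lambda>n. gaugePS n z *\<^sub>2 w n) (fst v, 1 * snd v) at_bot"
    if "jost_limit z w v at_bot"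
    using gaugePS_limit[OF z that qr_tendsto_zero(2,4) DE_shift_tendsto(4) DE_tendsto(2)] by simp
  show "jost_limit z (\<lambda>n. gaugePS n z *\<^sub>2 w n) (Einf q r * fst v, Dinf q r * 1 * snd v) at_top"
    if "jost_limit z w v at_top"
    using gaugePS_limit[OF z that qr_tendsto_zero(1,3) DE_shift_tendsto(3) DE_tendsto(1)] by simp
  show "((\<lambda>n. (1 - inverse z * inverse z) * (fst (gaugePS n z *\<^sub>2 w n) * z powi n)) \<longlongrightarrow>
      (1 - inverse z * inverse z) * (Einf q r * l)) at_top"
    if "is_sol (sysQ q r) z w" "((\<lambda>n. fst (w n) * z powi n) \<longlongrightarrow> l) at_top"
    by (rule gaugePS_top_fst[OF z that])
  show "((\<lambda>n. (1 - inverse z * inverse z) * (snd (gaugePS n z *\<^sub>2 w n) * z powi (- n))) \<longlongrightarrow>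
      (1 - inverse z * inverse z) * (Dinf q r * 1 * l)) at_top"
    if "is_sol (sysQ q r) z w" "((\<lambda>n. snd (w n) * z powi (- n)) \<longlongrightarrow> l) at_top"
    using tendsto_mult_left[OF gaugePS_top_snd[OF z that], of "1 - inverse z * inverse z"]
    by (simp only: mult_1_right)
qed (simp_all add: gaugePS_def inner_ext_const outer_ext_const
    one_minus_inverse_sq_ext one_minus_inverse_sq_nz[simplified]
    gaugePS_sol[unfolded gaugePS_def])

end

section \<open>From single blocks to the full matrices\<close>

theorem theorem4p6:
  fixes q r :: "int \<Rightarrow> complex"
    and N Nb :: nat and zs zbs :: "nat \<Rightarrow> complex" and ms mbs :: "nat \<Rightarrow> nat"
    and dQ dUV dPS :: sdata
  assumes "rapid_decay q" and "rapid_decay r"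
    and "\<And>n. 1 - q n * r n \<noteq> 0" and "\<And>n. 1 + q n * r (n + 1) \<noteq> 0"
    and "pole_config N zs ms Nb zbs mbs"
    and "scattering_data (sysQ q r) N zs ms Nb zbs mbs dQ"
    and "scattering_data (sysU (pot_u q r) (pot_v q r)) N zs ms Nb zbs mbs dUV"
    and "scattering_data (sysU (pot_p q r) (pot_s q r)) N zs ms Nb zbs mbs dPS"
  shows
    "(\<forall>j\<in>{1..N}. Cblk dUV zs ms j = Cblk dPS zs ms j * IminusAm2 (Ablk zs ms j)) \<and>
     (\<forall>j\<in>{1..Nb}. Cblkb dPS zbs mbs j = Cblkb dUV zbs mbs j * IminusAm2 (Ablk zbs mbs j)) \<and>
     Cfull dUV N zs ms = Cfull dPS N zs ms * IminusAm2 (Afull N zs ms) \<and>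
     Cfullb dPS Nb zbs mbs = Cfullb dUV Nb zbs mbs * IminusAm2 (Afull Nb zbs mbs) \<and>
     (\<forall>j\<in>{1..N}. Cblk dQ zs ms j = (Einf q r / Dinf q r) \<cdot>\<^sub>m Cblk dPS zs ms j) \<and>
     (\<forall>j\<in>{1..Nb}. Cblkb dQ zbs mbs j = (Dinf q r / Einf q r) \<cdot>\<^sub>m Cblkb dPS zbs mbs j) \<and>
     Cfull dPS N zs ms = (Dinf q r / Einf q r) \<cdot>\<^sub>m Cfull dQ N zs ms \<and>
     Cfullb dPS Nb zbs mbs = (Einf q r / Dinf q r) \<cdot>\<^sub>m Cfullb dQ Nb zbs mbs \<and>
     Cfull dUV N zs ms = ((Dinf q r / Einf q r) \<cdot>\<^sub>m Cfull dQ N zs ms) * IminusAm2 (Afull N zs ms) \<and>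
     Cfullb dUV Nb zbs mbs =
       ((Einf q r / Dinf q r) \<cdot>\<^sub>m Cfullb dQ Nb zbs mbs) * minv (IminusAm2 (Afull Nb zbs mbs))"
proof -
  interpret decaying_potentials q r
    by unfold_locales (use assms in auto)
  define \<kappa> where "\<kappa> = Dinf q r / Einf q r"
  have \<kappa>: "\<kappa> \<noteq> 0" "Einf q r / Dinf q r = 1 / \<kappa>"
    using Dinf_nz Einf_nz by (simp_all add: \<kappa>_def)
  have zs_nz: "zs j \<noteq> 0" if "j \<in> {1..N}" for j
    using assms(5) that unfolding pole_config_def by auto
  have zbs_nz: "zbs j \<noteq> 0" "(zbs j)\<^sup>2 \<noteq> 1" if "j \<in> {1..Nb}" for j
  proof -
    have "cmod (zbs j) > 1"
      using assms(5) that unfolding pole_config_def by auto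
    then show "zbs j \<noteq> 0" "(zbs j)\<^sup>2 \<noteq> 1"
      by (auto simp: power2_eq_1_iff)
  qed
  note data = assms(6-8)[unfolded scattering_data_def]
  have jost: "jost_solutions (sysQ q r) dQ" "jost_solutions (sysU (pot_u q r) (pot_v q r)) dUV"
      "jost_solutions (sysU (pot_p q r) (pot_s q r)) dPS"
    and trans: "transmission dQ" "transmission dUV" "transmission dPS"
    and poles: "has_poles dQ N zs ms Nb zbs mbs"
    and dep: "dependency dQ N zs ms Nb zbs mbs" "dependency dUV N zs ms Nb zbs mbs"
      "dependency dPS N zs ms Nb zbs mbs"
    using data by blast+
  have car: "Cblk x zs ms j \<in> carrier_mat 1 (ms j)" "Cblkb x zbs mbs j \<in> carrier_mat 1 (mbs j)"
    "Ablk zs ms j \<in> carrier_mat (ms j) (ms j)" "Ablk zbs mbs j \<in> carrier_mat (mbs j) (mbs j)" for x j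
    by (simp_all only: Cblk_eq_coeff_row coeff_row_carrier Ablk_def jordan_block_carrier)
  note car' = car(3)[THEN IminusAm2_carrier] car(4)[THEN IminusAm2_carrier]
  have PS: "Cblk dPS zs ms j = \<kappa> \<cdot>\<^sub>m Cblk dQ zs ms j" if "j \<in> {1..N}" for j
    using gPS.Cblk_gauge[OF jost(1,3) trans(1,3) assms(5) poles dep(1,3) that]
    by (simp add: \<kappa>_def Cblk_eq_coeff_row)
  have PSb: "Cblkb dPS zbs mbs j = (1 / \<kappa>) \<cdot>\<^sub>m Cblkb dQ zbs mbs j" if "j \<in> {1..Nb}" for j
    using gPS.Cblkb_gauge[OF jost(1,3) trans(1,3) assms(5) poles dep(1,3) that]
    by (simp add: \<kappa> Cblk_eq_coeff_row)
  have UV: "Cblk dUV zs ms j = Cblk dPS zs ms j * IminusAm2 (Ablk zs ms j)" if j: "j \<in> {1..N}" for j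
  proof -
    have "Cblk dUV zs ms j = \<kappa> \<cdot>\<^sub>m (Cblk dQ zs ms j * IminusAm2 (Ablk zs ms j))"
      using gUV.Cblk_gauge[OF jost(1,2) trans(1,2) assms(5) poles dep(1,2) j]
      by (simp only: \<kappa>_def Cblk_eq_coeff_row Ablk_def coeff_row_IminusAm2[OF zs_nz[OF j]])
    \<comment> \<open>Passing from the row of (Q) to that of \<open>(p, s)\<close> absorbs the
      constant \<open>\<kappa>\<close>.\<close>
    then show ?thesis
      unfolding PS[OF j] by (simp only: mult_smult_assoc_mat[OF car(1) car'(1)])
  qed
  \<comment> \<open>Both sides are \<open>1 / \<kappa>\<close> times the row of (Q), the right one
    because \<open>h\<close> stands with the target in \<open>Cblkb_gauge\<close>.\<close>
  have UVb: "Cblkb dPS zbs mbs j = Cblkb dUV zbs mbs j * IminusAm2 (Ablk zbs mbs j)"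
    if j: "j \<in> {1..Nb}" for j
    using gUV.Cblkb_gauge[OF jost(1,2) trans(1,2) assms(5) poles dep(1,2) j]
    unfolding PSb[OF j] \<kappa>(2)
    by (simp only: Cblk_eq_coeff_row Ablk_def coeff_row_IminusAm2[OF zbs_nz(1)[OF j]])
  have det: "det (Ablk zs ms j) \<noteq> 0" if "j \<in> set [1..<N+1]" for j
  proof -
    have "j \<in> {1..N}" using that by auto
    then show ?thesis using zs_nz by (simp add: Ablk_def det_jordan_block)
  qed
  have detb: "det (Ablk zbs mbs j) \<noteq> 0" "det (IminusAm2 (Ablk zbs mbs j)) \<noteq> 0"
    if "j \<in> set [1..<Nb+1]" for j
  proof -
    have j: "j \<in> {1..Nb}" using that by auto
    show "det (Ablk zbs mbs j) \<noteq> 0"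
      using zbs_nz(1)[OF j] by (simp add: Ablk_def det_jordan_block)
    show "det (IminusAm2 (Ablk zbs mbs j)) \<noteq> 0"
      unfolding Ablk_def by (rule det_IminusAm2_jordan_block[OF zbs_nz[OF j]])
  qed
  have blocks: "IminusAm2 (Afull N zs ms) = diag_block_mat (map (\<lambda>j. IminusAm2 (Ablk zs ms j)) [1..<N+1])"
    unfolding Afull_def by (rule IminusAm2_diag_block_mat[where d = ms]) (rule car det | assumption)+
  have blocksb: "IminusAm2 (Afull Nb zbs mbs) =
      diag_block_mat (map (\<lambda>j. IminusAm2 (Ablk zbs mbs j)) [1..<Nb+1])"
    unfolding Afull_def by (rule IminusAm2_diag_block_mat[where d = mbs]) (rule car detb | assumption)+
  have full_UV: "Cfull dUV N zs ms = Cfull dPS N zs ms * IminusAm2 (Afull N zs ms)"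
  proof -
    have "Cfull dUV N zs ms = hconcat (map (\<lambda>j. Cblk dPS zs ms j * IminusAm2 (Ablk zs ms j)) [1..<N+1])"
      unfolding Cfull_def by (rule arg_cong[where f = hconcat], rule map_cong) (use UV in auto)
    also have "\<dots> = Cfull dPS N zs ms * IminusAm2 (Afull N zs ms)"
      unfolding Cfull_def blocks
      by (rule hconcat_mult_diag_block_mat[symmetric, where d = ms]) (rule car car')+
    finally show ?thesis .
  qed
  have full_UVb: "Cfullb dPS Nb zbs mbs = Cfullb dUV Nb zbs mbs * IminusAm2 (Afull Nb zbs mbs)"
  proof -
    have "Cfullb dPS Nb zbs mbs =
        hconcat (map (\<lambda>j. Cblkb dUV zbs mbs j * IminusAm2 (Ablk zbs mbs j)) [1..<Nb+1])"
      unfolding Cfullb_def by (rule arg_cong[where f = hconcat], rule map_cong) (use UVb in auto)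
    also have "\<dots> = Cfullb dUV Nb zbs mbs * IminusAm2 (Afull Nb zbs mbs)"
      unfolding Cfullb_def blocksb
      by (rule hconcat_mult_diag_block_mat[symmetric, where d = mbs]) (rule car car')+
    finally show ?thesis .
  qed
  have full_PS: "Cfull dPS N zs ms = \<kappa> \<cdot>\<^sub>m Cfull dQ N zs ms"
  proof -
    have "Cfull dPS N zs ms = hconcat (map (\<lambda>j. \<kappa> \<cdot>\<^sub>m Cblk dQ zs ms j) [1..<N+1])"
      unfolding Cfull_def by (rule arg_cong[where f = hconcat], rule map_cong) (use PS in auto)
    also have "\<dots> = \<kappa> \<cdot>\<^sub>m Cfull dQ N zs ms"
      unfolding Cfull_def by (rule hconcat_smult[where d = ms]) (rule car)
    finally show ?thesis .
  qed
  have full_PSb: "Cfullb dPS Nb zbs mbs = (1 / \<kappa>) \<cdot>\<^sub>m Cfullb dQ Nb zbs mbs"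
  proof -
    have "Cfullb dPS Nb zbs mbs = hconcat (map (\<lambda>j. (1 / \<kappa>) \<cdot>\<^sub>m Cblkb dQ zbs mbs j) [1..<Nb+1])"
      unfolding Cfullb_def by (rule arg_cong[where f = hconcat], rule map_cong) (use PSb in auto)
    also have "\<dots> = (1 / \<kappa>) \<cdot>\<^sub>m Cfullb dQ Nb zbs mbs"
      unfolding Cfullb_def by (rule hconcat_smult[where d = mbs]) (rule car)
    finally show ?thesis .
  qed
  \<comment> \<open>The matrix factor can be moved across because its diagonal blocks are
    invertible: the poles outside the disc have squares different from 1.\<close>
  have "Cfullb dUV Nb zbs mbs = Cfullb dPS Nb zbs mbs * minv (IminusAm2 (Afull Nb zbs mbs))"
  proof -
    let ?n = "sum_list (map mbs [1..<Nb+1])"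
    have "IminusAm2 (Afull Nb zbs mbs) \<in> carrier_mat ?n ?n"
      unfolding Afull_def by (rule IminusAm2_carrier, rule diag_block_mat_carrier, rule car)
    moreover have "det (IminusAm2 (Afull Nb zbs mbs)) \<noteq> 0"
      unfolding blocksb
      by (rule minv_diag_block_mat(1)[where d = mbs]) (rule car' detb(2) | assumption)+
    moreover have "Cfullb dUV Nb zbs mbs \<in> carrier_mat 1 ?n"
      unfolding Cfullb_def by (rule hconcat_carrier, rule car)
    ultimately show ?thesis
      unfolding full_UVb by (rule mult_minv_cancel(1)[symmetric])
  qed
  moreover have "Cblk dQ zs ms j = (1 / \<kappa>) \<cdot>\<^sub>m Cblk dPS zs ms j" if "j \<in> {1..N}" for j
    unfolding PS[OF that] using \<kappa>(1) by (auto intro!: eq_matI)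
  moreover have "Cblkb dQ zbs mbs j = \<kappa> \<cdot>\<^sub>m Cblkb dPS zbs mbs j" if "j \<in> {1..Nb}" for j
    unfolding PSb[OF that] using \<kappa>(1) by (auto intro!: eq_matI)
  ultimately show ?thesis
    unfolding \<kappa>(2) \<kappa>_def[symmetric]
    using UV UVb full_UV full_UVb full_PS full_PSb by metis
qed

end
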